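(* For all program modules $\mathcal P,\mathcal Q,\mathcal P_i,\mathcal Q_i$ over $\Sigma$: 1. $\mathcal P\equiv_D\mathcal Q$ implies $Ob(\mathcal P)=Ob(\mathcal Q)$. 2. $\mathcal P_i\equiv_D\mathcal Q_i$ for $i=1,2$ implies $\mathcal P_1\cup\mathcal P_2\equiv_D\mathcal Q_1\cup\mathcal Q_2$. 3. $\mathcal P\equiv_D\mathcal Q$ implies $\overline{\mathcal P}^{\sigma}\equiv_D\overline{\mathcal Q}^{\sigma}$ for every $\sigma\subseteq FS_\Sigma$. 4. $\mathcal P\equiv_D\mathcal Q$ implies $\mathcal P\setminus\sigma\equiv_D\mathcal Q\setminus\sigma$ for every $\sigma\subseteq FS_\Sigma$. 5. $\mathcal P\equiv_D\mathcal Q$ implies $\rho(\mathcal P)\equiv_D\rho(\mathcal Q)$ for every function symbol renaming $\rho$. Thus the equivalence $\equiv_D$ is compositional with respect to $(Ob,\{\cup,\overline{(\cdot)}^{\sigma},(\cdot)\setminus\sigma,\rho(\cdot)\})$, i.e. it preserves $Ob$ and is a congruence for these operations.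
   Context: Terms. $\Sigma=(DS_\Sigma,FS_\Sigma)$ consists of countable disjoint sets of constructor symbols and of (defined) function symbols, each with an arity; $DS^n_\Sigma$, $FS^n_\Sigma$ are the symbols of arity $n\ge 0$. $\mathcal V$ is a countably infinite set of variables; $\bot$ is an extra 0-ary constructor. $\mathbf{Term}_\bot$ is the set of terms over $DS_\Sigma\cup FS_\Sigma\cup\{\bot\}$ and $\mathcal V$; $\mathbf{CTerm}_\bot$ is the subset of terms without function symbols; $\mathbf{Term}$, $\mathbf{CTerm}$ are the respective subsets of terms not containing $\bot$. $\mathbf{CSubst}_\bot$ (resp. $\mathbf{CSubst}$) is the set of maps $\theta:\mathcal V\to\mathbf{CTerm}_\bot$ (resp. $\mathcal V\to\mathbf{CTerm}$), extended to terms and written $t\theta$. Formulas are reduction statements $a\to b$ and joinability statements $a\bowtie b$ with $a,b\in\mathbf{Term}_\bot$. $\sqsubseteq$ is the least partial order on $\mathbf{CTerm}_\bot$ with $\bot\sqsubseteq t$ and $c(\overline s)\sqsubseteq c(\overline t)$ whenever $c\in DS^n_\Sigma$ and $s_i\sqsubseteq t_i$ for all $i$; $\langle t\rangle=\{s\in\mathbf{CTerm}_\bot\mid s\sqsubseteq t\}$. A cone is a non-empty subset of $\mathbf{CTerm}_\bot$ closed downwards under $\sqsubseteq$. Programs. A program is a set $\mathcal R$ of rules $f(\overline t)\to r\Leftarrow C$ with $f\in FS^n_\Sigma$, $\overline t$ an $n$-tuple of terms of $\mathbf{CTerm}$ in which no variable occurs twice, $r\in\mathbf{Term}_\bot$,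 and $C$ a finite set of joinability statements between terms of $\mathbf{Term}$. $[\mathcal R]_\bot$ is the set of all instances $(l\to r\Leftarrow C)\theta$ of rules of $\mathcal R$ with $\theta\in\mathbf{CSubst}_\bot$. Provability. $\mathcal R\vdash_{CRWL}\varphi$ means $\varphi$ is derivable with: (Bo) $e\to\bot$ for $e\in\mathbf{Term}_\bot$; (RR) $e\to e$ for $e\in\mathcal V\cup DS^0_\Sigma$; (DS) from $e_i\to t_i$ ($1\le i\le n$) infer $c(\overline e)\to c(\overline t)$, for $c\in DS^n_\Sigma$; (OR) from $e_i\to t_i$ ($1\le i\le n$), all statements of $C$, and $r\to t$ infer $f(\overline e)\to t$, if $(f(\overline t)\to r\Leftarrow C)\in[\mathcal R]_\bot$ and $t\neq\bot$; (Jo) from $a\to t$ and $b\to t$ infer $a\bowtie b$, if $t\in\mathbf{CTerm}$. Term algebras. A (CRWL-)term algebra $\mathcal A$ has carrier $\mathbf{CTerm}_\bot$, interprets each $c\in DS^n_\Sigma$ by $c^{\mathcal A}(\overline t)=\langle c(\overline t)\rangle$, and each $f\in FS^n_\Sigma$ by a monotonic map $f^{\mathcal A}$ from $(\mathbf{CTerm}_\bot)^n$ to cones ordered by inclusion (a cone if $n=0$). $\mathbf{TAlg}_\Sigma$ is the set of them, ordered by $\mathcal A\sqsubseteq\mathcal B$ iff $f^{\mathcal A}(\overline t)\subseteq f^{\mathcal B}(\overline t)$ for all $f,\overline t$. $\mathcal A$ is consistent iff $\{u\theta\mid u\in f^{\mathcal A}(\overline t)\}\subseteq f^{\mathcal A}(\overline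 t\theta)$ for all $f\in FS^n_\Sigma$, $t_i\in\mathbf{CTerm}_\bot$, $\theta\in\mathbf{CSubst}$; $\mathbf{CTAlg}_\Sigma$ is the set of consistent term algebras. Evaluation under $\eta:\mathcal V\to\mathbf{CTerm}_\bot$: $[\![\bot]\!]^{\mathcal A}_\eta=\langle\bot\rangle$, $[\![X]\!]^{\mathcal A}_\eta=\langle\eta(X)\rangle$, $[\![h(e_1,\dots,e_n)]\!]^{\mathcal A}_\eta=\bigcup\{h^{\mathcal A}(u_1,\dots,u_n)\mid u_i\in[\![e_i]\!]^{\mathcal A}_\eta\}$. $id$ is the identity valuation. $\mathcal A\models_\eta a\bowtie b$ iff $[\![a]\!]^{\mathcal A}_\eta\cap[\![b]\!]^{\mathcal A}_\eta$ contains an element of $\mathbf{CTerm}$ (a maximal element); $\mathcal A\models_\eta C$ iff this holds for all statements of $C$. For a program $\mathcal R$, $\mathcal T_{\mathcal R}:\mathbf{TAlg}_\Sigma\to\mathbf{TAlg}_\Sigma$ is given by $f^{\mathcal T_{\mathcal R}(\mathcal A)}(\overline t)=\{t\mid\exists(f(\overline s)\to r\Leftarrow C)\in[\mathcal R]_\bot,\ s_i\sqsubseteq t_i\text{ for all }i,\ \mathcal A\models_{id}C,\ t\in[\![r]\!]^{\mathcal A}_{id}\}\cup\{\bot\}$. $\mathcal M_{\mathcal R}$ is the term algebra with $f^{\mathcal M_{\mathcal R}}(\overline t)=\{r\in\mathbf{CTerm}_\bot\mid\mathcal R\vdash_{CRWL}f(\overline t)\to r\}$. Modules. A module is $\mathcal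 P=\langle\sigma_p,\sigma_e,\mathcal R\rangle$ with $\mathcal R$ a program whose rules have right-hand sides $r\ne\bot$, $\sigma_e=exp(\mathcal P)$ the set of function symbols having a defining rule in $\mathcal R$, and $\sigma_p$ the set of function symbols occurring in $\mathcal R$ without a defining rule in $\mathcal R$; $rl(\mathcal P)=\mathcal R$, and $\mathcal T_{\mathcal P}$, $\mathcal M_{\mathcal P}$ mean $\mathcal T_{rl(\mathcal P)}$, $\mathcal M_{rl(\mathcal P)}$. A module is determined by its rules. Operations: - union: $rl(\mathcal P_1\cup\mathcal P_2)=rl(\mathcal P_1)\cup rl(\mathcal P_2)$; - deletion: $rl(\mathcal P\setminus\sigma)$ is the set of rules of $\mathcal P$ that define function symbols not in $\sigma$; - closure: $rl(\overline{\mathcal P}^{\sigma})=\{crr(f(\overline t),r)\mid f\in\sigma,\ t_i\in\mathbf{CTerm}_\bot,\ r\in\mathbf{CTerm}_\bot,\ r\ne\bot,\ rl(\mathcal P)\vdash_{CRWL}f(\overline t)\to r\}$, where $crr(f(\overline t),r)$ is the rule $f(\overline t')\to r\Leftarrow C$ obtained by replacing in $\overline t$ each occurrence of $\bot$ and each occurrence other than the first of a variable occurring more than once by a distinct fresh variable, and letting $C$ consist of $X\bowtie Y$ for each fresh $Y$ replacing an occurrence of a repeated variable $X$, and $X\bowtie X$ for each variable $X$ of $r$ and each variable $X$ occurring exactly once in $\overline t$; - renaming: a function symbol renaming is a map $\rho:FS_\Sigma\to FS_\Sigma$ preserving arities; it acts on terms and rules by replacing every function symbol $f$ by $\rho(f)$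 (constructors, variables and $\bot$ fixed), and $rl(\rho(\mathcal P))=\{\rho(R)\mid R\in rl(\mathcal P)\}$. Equivalences. $Ob(\mathcal P)=\mathcal M_{\mathcal P}$. $\mathcal P\equiv_{CM}\mathcal Q$ iff for all $\mathcal A\in\mathbf{CTAlg}_\Sigma$: $\mathcal T_{\mathcal P}(\mathcal A)\sqsubseteq\mathcal A\Leftrightarrow\mathcal T_{\mathcal Q}(\mathcal A)\sqsubseteq\mathcal A$. $\mathcal P\equiv_D\mathcal Q$ (deletion equivalence) iff $\mathcal P\setminus\sigma\equiv_{CM}\mathcal Q\setminus\sigma$ for all $\sigma\subseteq FS_\Sigma$. *)

theory Defs
  imports "HOL-Library.Countable_Set" "HOL-Library.Infinite_Typeclass"
begin

section \<open>Terms\<close>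

record ('c, 'f) signature =
  DS :: "'c set"
  FS :: "'f set"
  arD :: "'c \<Rightarrow> nat"
  arF :: "'f \<Rightarrow> nat"

text \<open>Constructor and function symbols are disjoint because terms tag them differently; the two
  sets may be empty, and the arities matter only on the two sets.\<close>

definition wf_signature :: "('c, 'f) signature \<Rightarrow> bool" where
  "wf_signature \<Sigma> \<longleftrightarrow> countable (DS \<Sigma>) \<and> countable (FS \<Sigma>)"

text \<open>The variables are the elements of a type \<open>'v\<close>, which the theorem assumes to be countably
  infinite.\<close>

datatype (cons: 'c, funs: 'f, vars: 'v) trm =
    Var 'v
  | Bot
  | Con 'c "('c, 'f, 'v) trm list"
  | Fun 'f "('c, 'f, 'v) trm list"
  for map: map_trm

fun wf_trm :: "('c, 'f) signature \<Rightarrow> ('c, 'f, 'v) trm \<Rightarrow> bool" where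
  "wf_trm \<Sigma> (Var x) \<longleftrightarrow> True"
| "wf_trm \<Sigma> Bot \<longleftrightarrow> True"
| "wf_trm \<Sigma> (Con c ts) \<longleftrightarrow> c \<in> DS \<Sigma> \<and> length ts = arD \<Sigma> c \<and> (\<forall>t\<in>set ts. wf_trm \<Sigma> t)"
| "wf_trm \<Sigma> (Fun f ts) \<longleftrightarrow> f \<in> FS \<Sigma> \<and> length ts = arF \<Sigma> f \<and> (\<forall>t\<in>set ts. wf_trm \<Sigma> t)"

fun bot_free :: "('c, 'f, 'v) trm \<Rightarrow> bool" where
  "bot_free (Var x) \<longleftrightarrow> True"
| "bot_free Bot \<longleftrightarrow> False"
| "bot_free (Con c ts) \<longleftrightarrow> (\<forall>t\<in>set ts. bot_free t)"
| "bot_free (Fun f ts) \<longleftrightarrow> (\<forall>t\<in>set ts. bot_free t)"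

definition Term_bot :: "('c, 'f) signature \<Rightarrow> ('c, 'f, 'v) trm set" where
  "Term_bot \<Sigma> = {t. wf_trm \<Sigma> t}"

definition CTerm_bot :: "('c, 'f) signature \<Rightarrow> ('c, 'f, 'v) trm set" where
  "CTerm_bot \<Sigma> = {t \<in> Term_bot \<Sigma>. funs t = {}}"

definition Term :: "('c, 'f) signature \<Rightarrow> ('c, 'f, 'v) trm set" where
  "Term \<Sigma> = {t \<in> Term_bot \<Sigma>. bot_free t}"

definition CTerm :: "('c, 'f) signature \<Rightarrow> ('c, 'f, 'v) trm set" where
  "CTerm \<Sigma> = {t \<in> CTerm_bot \<Sigma>. bot_free t}"

text \<open>The argument tuples \<open>(CTerm_bot)\<^sup>n\<close> of a function symbol of arity \<open>n\<close>.\<close>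

definition cargs :: "('c, 'f) signature \<Rightarrow> 'f \<Rightarrow> ('c, 'f, 'v) trm list set" where
  "cargs \<Sigma> f = {ts. length ts = arF \<Sigma> f \<and> set ts \<subseteq> CTerm_bot \<Sigma>}"

fun subst :: "('v \<Rightarrow> ('c, 'f, 'v) trm) \<Rightarrow> ('c, 'f, 'v) trm \<Rightarrow> ('c, 'f, 'v) trm" where
  "subst \<theta> (Var x) = \<theta> x"
| "subst \<theta> Bot = Bot"
| "subst \<theta> (Con c ts) = Con c (map (subst \<theta>) ts)"
| "subst \<theta> (Fun f ts) = Fun f (map (subst \<theta>) ts)"

definition CSubst_bot :: "('c, 'f) signature \<Rightarrow> ('v \<Rightarrow> ('c, 'f, 'v) trm) set" where
  "CSubst_bot \<Sigma> = {\<theta>. \<forall>x. \<theta> x \<in> CTerm_bot \<Sigma>}"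

definition CSubst :: "('c, 'f) signature \<Rightarrow> ('v \<Rightarrow> ('c, 'f, 'v) trm) set" where
  "CSubst \<Sigma> = {\<theta>. \<forall>x. \<theta> x \<in> CTerm \<Sigma>}"

text \<open>The least preorder with the two closure properties; it is antisymmetric
  (\<open>approx_antisym\<close> below), hence also the least such partial order.\<close>

inductive approx :: "('c, 'f) signature \<Rightarrow> ('c, 'f, 'v) trm \<Rightarrow> ('c, 'f, 'v) trm \<Rightarrow> bool"
  for \<Sigma> where
  approx_refl: "t \<in> CTerm_bot \<Sigma> \<Longrightarrow> approx \<Sigma> t t"
| approx_trans: "approx \<Sigma> s t \<Longrightarrow> approx \<Sigma> t u \<Longrightarrow> approx \<Sigma> s u"
| approx_bot: "t \<in> CTerm_bot \<Sigma> \<Longrightarrow> approx \<Sigma> Bot t"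
| approx_con: "c \<in> DS \<Sigma> \<Longrightarrow> length ss = arD \<Sigma> c \<Longrightarrow> length ts = arD \<Sigma> c \<Longrightarrow>
    (\<And>i. i < arD \<Sigma> c \<Longrightarrow> approx \<Sigma> (ss ! i) (ts ! i)) \<Longrightarrow> approx \<Sigma> (Con c ss) (Con c ts)"

lemma approx_shape:
  "approx \<Sigma> s t \<Longrightarrow> s = Bot \<or> s = t \<or>
    (\<exists>c ss ts. s = Con c ss \<and> t = Con c ts \<and> list_all2 (approx \<Sigma>) ss ts)"
proof (induction rule: approx.induct)
  case (approx_trans s t u)
  then show ?case
    by (elim disjE exE conjE; simp)
      (blast intro: list_all2_trans[of "approx \<Sigma>" "approx \<Sigma>" "approx \<Sigma>"] approx.approx_trans)
qed (auto simp: list_all2_conv_all_nth)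

lemma approx_antisym: "approx \<Sigma> s t \<Longrightarrow> approx \<Sigma> t s \<Longrightarrow> s = t"
proof (induction s arbitrary: t)
  case (Con c ss)
  from approx_shape[OF Con.prems(1)] approx_shape[OF Con.prems(2)] show ?case
    by (auto simp: list_all2_conv_all_nth intro!: nth_equalityI Con.IH)
qed (auto dest: approx_shape)

definition down :: "('c, 'f) signature \<Rightarrow> ('c, 'f, 'v) trm \<Rightarrow> ('c, 'f, 'v) trm set" where
  "down \<Sigma> t = {s \<in> CTerm_bot \<Sigma>. approx \<Sigma> s t}"

definition cone :: "('c, 'f) signature \<Rightarrow> ('c, 'f, 'v) trm set \<Rightarrow> bool" where
  "cone \<Sigma> K \<longleftrightarrow> K \<noteq> {} \<and> K \<subseteq> CTerm_bot \<Sigma> \<and> (\<forall>t\<in>K. \<forall>s. approx \<Sigma> s t \<longrightarrow> s \<in> K)"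


section \<open>Programs and provability\<close>

text \<open>\<open>Rule f ts r C\<close> is \<open>f(ts) \<rightarrow> r \<Leftarrow> C\<close>; a pair \<open>(a, b) \<in> C\<close> is the joinability statement
  \<open>a \<bowtie> b\<close>.\<close>

datatype ('c, 'f, 'v) rule =
  Rule (head: 'f) (largs: "('c, 'f, 'v) trm list") (rhs: "('c, 'f, 'v) trm")
    (conds: "(('c, 'f, 'v) trm \<times> ('c, 'f, 'v) trm) set")

fun var_occs :: "('c, 'f, 'v) trm \<Rightarrow> 'v list" where
  "var_occs (Var x) = [x]"
| "var_occs Bot = []"
| "var_occs (Con c ts) = concat (map var_occs ts)"
| "var_occs (Fun f ts) = concat (map var_occs ts)"

abbreviation vars_occs :: "('c, 'f, 'v) trm list \<Rightarrow> 'v list" where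
  "vars_occs ts \<equiv> concat (map var_occs ts)"

definition wf_rule :: "('c, 'f) signature \<Rightarrow> ('c, 'f, 'v) rule \<Rightarrow> bool" where
  "wf_rule \<Sigma> R \<longleftrightarrow>
     head R \<in> FS \<Sigma> \<and> length (largs R) = arF \<Sigma> (head R) \<and> set (largs R) \<subseteq> CTerm \<Sigma> \<and>
     distinct (vars_occs (largs R)) \<and> rhs R \<in> Term_bot \<Sigma> \<and>
     finite (conds R) \<and> conds R \<subseteq> Term \<Sigma> \<times> Term \<Sigma>"

definition program :: "('c, 'f) signature \<Rightarrow> ('c, 'f, 'v) rule set \<Rightarrow> bool" where
  "program \<Sigma> \<R> \<longleftrightarrow> (\<forall>R\<in>\<R>. wf_rule \<Sigma> R)"

fun subst_rule :: "('v \<Rightarrow> ('c, 'f, 'v) trm) \<Rightarrow> ('c, 'f, 'v) rule \<Rightarrow> ('c, 'f, 'v) rule" where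
  "subst_rule \<theta> (Rule f ts r C) =
     Rule f (map (subst \<theta>) ts) (subst \<theta> r) (map_prod (subst \<theta>) (subst \<theta>) ` C)"

definition instances ::
  "('c, 'f) signature \<Rightarrow> ('c, 'f, 'v) rule set \<Rightarrow> ('c, 'f, 'v) rule set" where
  "instances \<Sigma> \<R> = {subst_rule \<theta> R | \<theta> R. \<theta> \<in> CSubst_bot \<Sigma> \<and> R \<in> \<R>}"

datatype ('c, 'f, 'v) formula =
    Red "('c, 'f, 'v) trm" "('c, 'f, 'v) trm"
  | Join "('c, 'f, 'v) trm" "('c, 'f, 'v) trm"

inductive crwl ::
  "('c, 'f) signature \<Rightarrow> ('c, 'f, 'v) rule set \<Rightarrow> ('c, 'f, 'v) formula \<Rightarrow> bool"
  for \<Sigma> \<R> where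
  Bo: "e \<in> Term_bot \<Sigma> \<Longrightarrow> crwl \<Sigma> \<R> (Red e Bot)"
| RR_var: "crwl \<Sigma> \<R> (Red (Var x) (Var x))"
| RR_con: "c \<in> DS \<Sigma> \<Longrightarrow> arD \<Sigma> c = 0 \<Longrightarrow> crwl \<Sigma> \<R> (Red (Con c []) (Con c []))"
| DS: "c \<in> DS \<Sigma> \<Longrightarrow> length es = arD \<Sigma> c \<Longrightarrow> length ts = arD \<Sigma> c \<Longrightarrow>
    (\<And>i. i < arD \<Sigma> c \<Longrightarrow> crwl \<Sigma> \<R> (Red (es ! i) (ts ! i))) \<Longrightarrow>
    crwl \<Sigma> \<R> (Red (Con c es) (Con c ts))"
| OR: "Rule f ts r C \<in> instances \<Sigma> \<R> \<Longrightarrow> t \<noteq> Bot \<Longrightarrow> length es = length ts \<Longrightarrow>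
    (\<And>i. i < length ts \<Longrightarrow> crwl \<Sigma> \<R> (Red (es ! i) (ts ! i))) \<Longrightarrow>
    (\<And>a b. (a, b) \<in> C \<Longrightarrow> crwl \<Sigma> \<R> (Join a b)) \<Longrightarrow>
    crwl \<Sigma> \<R> (Red r t) \<Longrightarrow> crwl \<Sigma> \<R> (Red (Fun f es) t)"
| Jo: "t \<in> CTerm \<Sigma> \<Longrightarrow> crwl \<Sigma> \<R> (Red a t) \<Longrightarrow> crwl \<Sigma> \<R> (Red b t) \<Longrightarrow> crwl \<Sigma> \<R> (Join a b)"


section \<open>Term algebras\<close>

text \<open>Carrier and constructors have the same interpretation in all term algebras, so an algebra is
  given by the denotations of the function symbols. Outside its proper domain a denotation is fixed
  to be empty, so that HOL equality is equality of term algebras.\<close>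

type_synonym ('c, 'f, 'v) algebra = "'f \<Rightarrow> ('c, 'f, 'v) trm list \<Rightarrow> ('c, 'f, 'v) trm set"

definition TAlg :: "('c, 'f) signature \<Rightarrow> ('c, 'f, 'v) algebra set" where
  "TAlg \<Sigma> = {\<A>.
     (\<forall>f\<in>FS \<Sigma>. \<forall>ts\<in>cargs \<Sigma> f. cone \<Sigma> (\<A> f ts)) \<and>
     (\<forall>f\<in>FS \<Sigma>. \<forall>ss\<in>cargs \<Sigma> f. \<forall>ts\<in>cargs \<Sigma> f. list_all2 (approx \<Sigma>) ss ts \<longrightarrow> \<A> f ss \<subseteq> \<A> f ts) \<and>
     (\<forall>f ts. f \<notin> FS \<Sigma> \<or> ts \<notin> cargs \<Sigma> f \<longrightarrow> \<A> f ts = {})}"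

definition alg_le ::
  "('c, 'f) signature \<Rightarrow> ('c, 'f, 'v) algebra \<Rightarrow> ('c, 'f, 'v) algebra \<Rightarrow> bool" where
  "alg_le \<Sigma> \<A> \<B> \<longleftrightarrow> (\<forall>f\<in>FS \<Sigma>. \<forall>ts\<in>cargs \<Sigma> f. \<A> f ts \<subseteq> \<B> f ts)"

definition consistent :: "('c, 'f) signature \<Rightarrow> ('c, 'f, 'v) algebra \<Rightarrow> bool" where
  "consistent \<Sigma> \<A> \<longleftrightarrow> (\<forall>f\<in>FS \<Sigma>. \<forall>ts\<in>cargs \<Sigma> f. \<forall>\<theta>\<in>CSubst \<Sigma>.
     {subst \<theta> u | u. u \<in> \<A> f ts} \<subseteq> \<A> f (map (subst \<theta>) ts))"

definition CTAlg :: "('c, 'f) signature \<Rightarrow> ('c, 'f, 'v) algebra set" where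
  "CTAlg \<Sigma> = {\<A> \<in> TAlg \<Sigma>. consistent \<Sigma> \<A>}"

text \<open>\<open>listset [A\<^sub>1, \<dots>, A\<^sub>n]\<close> is the set of all lists \<open>[u\<^sub>1, \<dots>, u\<^sub>n]\<close> with \<open>u\<^sub>i \<in> A\<^sub>i\<close>.\<close>

fun eval :: "('c, 'f) signature \<Rightarrow> ('c, 'f, 'v) algebra \<Rightarrow> ('v \<Rightarrow> ('c, 'f, 'v) trm) \<Rightarrow>
    ('c, 'f, 'v) trm \<Rightarrow> ('c, 'f, 'v) trm set" where
  "eval \<Sigma> \<A> \<eta> (Var x) = down \<Sigma> (\<eta> x)"
| "eval \<Sigma> \<A> \<eta> Bot = down \<Sigma> Bot"
| "eval \<Sigma> \<A> \<eta> (Con c es) = (\<Union>us\<in>listset (map (eval \<Sigma> \<A> \<eta>) es). down \<Sigma> (Con c us))"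
| "eval \<Sigma> \<A> \<eta> (Fun f es) = (\<Union>us\<in>listset (map (eval \<Sigma> \<A> \<eta>) es). \<A> f us)"

definition sat_join :: "('c, 'f) signature \<Rightarrow> ('c, 'f, 'v) algebra \<Rightarrow> ('v \<Rightarrow> ('c, 'f, 'v) trm) \<Rightarrow>
    ('c, 'f, 'v) trm \<Rightarrow> ('c, 'f, 'v) trm \<Rightarrow> bool" where
  "sat_join \<Sigma> \<A> \<eta> a b \<longleftrightarrow> (\<exists>t \<in> CTerm \<Sigma>. t \<in> eval \<Sigma> \<A> \<eta> a \<inter> eval \<Sigma> \<A> \<eta> b)"

definition sat_conds :: "('c, 'f) signature \<Rightarrow> ('c, 'f, 'v) algebra \<Rightarrow> ('v \<Rightarrow> ('c, 'f, 'v) trm) \<Rightarrow>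
    (('c, 'f, 'v) trm \<times> ('c, 'f, 'v) trm) set \<Rightarrow> bool" where
  "sat_conds \<Sigma> \<A> \<eta> C \<longleftrightarrow> (\<forall>(a, b) \<in> C. sat_join \<Sigma> \<A> \<eta> a b)"

text \<open>The identity valuation is \<open>Var\<close>.\<close>

definition T_op ::
  "('c, 'f) signature \<Rightarrow> ('c, 'f, 'v) rule set \<Rightarrow> ('c, 'f, 'v) algebra \<Rightarrow> ('c, 'f, 'v) algebra" where
  "T_op \<Sigma> \<R> \<A> f ts =
     (if f \<in> FS \<Sigma> \<and> ts \<in> cargs \<Sigma> f
      then {t. \<exists>ss r C. Rule f ss r C \<in> instances \<Sigma> \<R> \<and> list_all2 (approx \<Sigma>) ss ts \<and>
                 sat_conds \<Sigma> \<A> Var C \<and> t \<in> eval \<Sigma> \<A> Var r} \<union> {Bot}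
      else {})"

definition M_alg :: "('c, 'f) signature \<Rightarrow> ('c, 'f, 'v) rule set \<Rightarrow> ('c, 'f, 'v) algebra" where
  "M_alg \<Sigma> \<R> f ts =
     (if f \<in> FS \<Sigma> \<and> ts \<in> cargs \<Sigma> f
      then {r \<in> CTerm_bot \<Sigma>. crwl \<Sigma> \<R> (Red (Fun f ts) r)}
      else {})"


section \<open>Modules\<close>

record ('c, 'f, 'v) module =
  params :: "'f set"
  exports :: "'f set"
  rl :: "('c, 'f, 'v) rule set"

definition defined_syms :: "('c, 'f, 'v) rule set \<Rightarrow> 'f set" where
  "defined_syms \<R> = head ` \<R>"

definition rule_syms :: "('c, 'f, 'v) rule \<Rightarrow> 'f set" where
  "rule_syms R = {head R} \<union> (\<Union>t\<in>set (largs R). funs t) \<union> funs (rhs R) \<union>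
     (\<Union>(a, b)\<in>conds R. funs a \<union> funs b)"

definition module_of :: "('c, 'f, 'v) rule set \<Rightarrow> ('c, 'f, 'v) module" where
  "module_of \<R> =
     \<lparr>params = (\<Union>R\<in>\<R>. rule_syms R) - defined_syms \<R>, exports = defined_syms \<R>, rl = \<R>\<rparr>"

definition modules :: "('c, 'f) signature \<Rightarrow> ('c, 'f, 'v) module set" where
  "modules \<Sigma> = {module_of \<R> | \<R>. program \<Sigma> \<R> \<and> (\<forall>R\<in>\<R>. rhs R \<noteq> Bot)}"

definition munion ::
  "('c, 'f, 'v) module \<Rightarrow> ('c, 'f, 'v) module \<Rightarrow> ('c, 'f, 'v) module" where
  "munion P Q = module_of (rl P \<union> rl Q)"

definition mdelete :: "('c, 'f, 'v) module \<Rightarrow> 'f set \<Rightarrow> ('c, 'f, 'v) module" where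
  "mdelete P \<sigma> = module_of {R \<in> rl P. head R \<notin> \<sigma>}"

text \<open>\<open>linearize\<close> makes the replacements of \<open>crr\<close> from left to right. Its state \<open>(S, U, C)\<close> consists
  of the variables \<open>S\<close> of the original term met so far, the variables \<open>U\<close> that are not fresh any more,
  and the conditions \<open>X \<bowtie> Y\<close> generated so far.\<close>

definition fresh :: "'v set \<Rightarrow> 'v" where
  "fresh U = (SOME y. y \<notin> U)"

type_synonym ('c, 'f, 'v) lin_state =
  "'v set \<times> 'v set \<times> (('c, 'f, 'v) trm \<times> ('c, 'f, 'v) trm) set"

fun linearize :: "('c, 'f, 'v) trm \<Rightarrow> ('c, 'f, 'v) lin_state \<Rightarrow>
      ('c, 'f, 'v) trm \<times> ('c, 'f, 'v) lin_state"
  and linearizes :: "('c, 'f, 'v) trm list \<Rightarrow> ('c, 'f, 'v) lin_state \<Rightarrow>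
      ('c, 'f, 'v) trm list \<times> ('c, 'f, 'v) lin_state" where
  "linearize (Var x) (S, U, C) =
     (if x \<notin> S then (Var x, insert x S, U, C)
      else let y = fresh U in (Var y, S, insert y U, insert (Var x, Var y) C))"
| "linearize Bot (S, U, C) = (let y = fresh U in (Var y, S, insert y U, C))"
| "linearize (Con c ts) s = (let (ts', s') = linearizes ts s in (Con c ts', s'))"
| "linearize (Fun f ts) s = (let (ts', s') = linearizes ts s in (Fun f ts', s'))"
| "linearizes [] s = ([], s)"
| "linearizes (t # ts) s =
     (let (t', s') = linearize t s; (ts', s'') = linearizes ts s' in (t' # ts', s''))"

definition crr ::
  "'f \<Rightarrow> ('c, 'f, 'v) trm list \<Rightarrow> ('c, 'f, 'v) trm \<Rightarrow> ('c, 'f, 'v) rule" where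
  "crr f ts r =
     (let (ts', S, U, C) = linearizes ts ({}, (\<Union>t\<in>set ts. vars t) \<union> vars r, {})
      in Rule f ts' r
           (C \<union> {(Var x, Var x) | x. x \<in> vars r \<or> count_list (vars_occs ts) x = 1}))"

definition mclosure ::
  "('c, 'f) signature \<Rightarrow> ('c, 'f, 'v) module \<Rightarrow> 'f set \<Rightarrow> ('c, 'f, 'v) module" where
  "mclosure \<Sigma> P \<sigma> = module_of {crr f ts r | f ts r.
     f \<in> \<sigma> \<and> ts \<in> cargs \<Sigma> f \<and> r \<in> CTerm_bot \<Sigma> \<and> r \<noteq> Bot \<and> crwl \<Sigma> (rl P) (Red (Fun f ts) r)}"

definition renaming :: "('c, 'f) signature \<Rightarrow> ('f \<Rightarrow> 'f) \<Rightarrow> bool" where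
  "renaming \<Sigma> \<rho> \<longleftrightarrow> (\<forall>f\<in>FS \<Sigma>. \<rho> f \<in> FS \<Sigma> \<and> arF \<Sigma> (\<rho> f) = arF \<Sigma> f)"

abbreviation rename_trm :: "('f \<Rightarrow> 'f) \<Rightarrow> ('c, 'f, 'v) trm \<Rightarrow> ('c, 'f, 'v) trm" where
  "rename_trm \<rho> \<equiv> map_trm id \<rho> id"

fun rename_rule :: "('f \<Rightarrow> 'f) \<Rightarrow> ('c, 'f, 'v) rule \<Rightarrow> ('c, 'f, 'v) rule" where
  "rename_rule \<rho> (Rule f ts r C) = Rule (\<rho> f) (map (rename_trm \<rho>) ts) (rename_trm \<rho> r)
     (map_prod (rename_trm \<rho>) (rename_trm \<rho>) ` C)"

definition mrename :: "('f \<Rightarrow> 'f) \<Rightarrow> ('c, 'f, 'v) module \<Rightarrow> ('c, 'f, 'v) module" where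
  "mrename \<rho> P = module_of (rename_rule \<rho> ` rl P)"


section \<open>Equivalences\<close>

definition Ob :: "('c, 'f) signature \<Rightarrow> ('c, 'f, 'v) module \<Rightarrow> ('c, 'f, 'v) algebra" where
  "Ob \<Sigma> P = M_alg \<Sigma> (rl P)"

definition CM_equiv ::
  "('c, 'f) signature \<Rightarrow> ('c, 'f, 'v) module \<Rightarrow> ('c, 'f, 'v) module \<Rightarrow> bool" where
  "CM_equiv \<Sigma> P Q \<longleftrightarrow> (\<forall>\<A>\<in>CTAlg \<Sigma>.
     alg_le \<Sigma> (T_op \<Sigma> (rl P) \<A>) \<A> \<longleftrightarrow> alg_le \<Sigma> (T_op \<Sigma> (rl Q) \<A>) \<A>)"

definition D_equiv ::
  "('c, 'f) signature \<Rightarrow> ('c, 'f, 'v) module \<Rightarrow> ('c, 'f, 'v) module \<Rightarrow> bool" where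
  "D_equiv \<Sigma> P Q \<longleftrightarrow> (\<forall>\<sigma>\<subseteq>FS \<Sigma>. CM_equiv \<Sigma> (mdelete P \<sigma>) (mdelete Q \<sigma>))"


section \<open>The operations yield modules\<close>

lemma rl_module_of [simp]: "rl (module_of \<R>) = \<R>"
  by (simp add: module_of_def)

lemma modules_iff:
  "P \<in> modules \<Sigma> \<longleftrightarrow> P = module_of (rl P) \<and> (\<forall>R\<in>rl P. wf_rule \<Sigma> R \<and> rhs R \<noteq> Bot)"
  by (force simp: modules_def program_def)

lemma munion_modules: "P \<in> modules \<Sigma> \<Longrightarrow> Q \<in> modules \<Sigma> \<Longrightarrow> munion P Q \<in> modules \<Sigma>"
  by (auto simp: modules_iff munion_def)

lemma mdelete_modules: "P \<in> modules \<Sigma> \<Longrightarrow> mdelete P \<sigma> \<in> modules \<Sigma>"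
  by (auto simp: modules_iff mdelete_def)

lemma wf_rename_trm: "renaming \<Sigma> \<rho> \<Longrightarrow> wf_trm \<Sigma> t \<Longrightarrow> wf_trm \<Sigma> (rename_trm \<rho> t)"
  by (induction t) (auto simp: renaming_def)

lemma bot_free_rename_trm [simp]: "bot_free (rename_trm \<rho> t) = bot_free t"
  by (induction t) auto

lemma var_occs_rename_trm [simp]: "var_occs (rename_trm \<rho> t) = var_occs t"
  by (induction t) (auto simp: o_def intro!: arg_cong[of _ _ concat])

lemma rename_trm_eq_Bot [simp]: "rename_trm \<rho> t = Bot \<longleftrightarrow> t = Bot"
  by (cases t) auto

lemma mrename_modules:
  assumes "renaming \<Sigma> \<rho>" "P \<in> modules \<Sigma>"
  shows "mrename \<rho> P \<in> modules \<Sigma>"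
proof -
  have "wf_rule \<Sigma> (rename_rule \<rho> R) \<and> rhs (rename_rule \<rho> R) \<noteq> Bot" if "R \<in> rl P" for R
  proof -
    from that assms(2) have R: "wf_rule \<Sigma> R" "rhs R \<noteq> Bot"
      by (auto simp: modules_iff)
    then show ?thesis
      using assms(1)
      by (cases R) (auto simp: wf_rule_def o_def CTerm_def CTerm_bot_def Term_bot_def Term_def
          trm.set_map wf_rename_trm subset_iff renaming_def)
  qed
  then show ?thesis
    by (auto simp: modules_iff mrename_def)
qed

lemma fresh_notin: "finite (U :: 'v::infinite set) \<Longrightarrow> fresh U \<notin> U"
  unfolding fresh_def using arb_element by (metis someI_ex)

lemma
  fixes t :: "('c, 'f, 'v::infinite) trm" and ts :: "('c, 'f, 'v) trm list"
  shows linearize_props: "linearize t (S, U, C) = (t', S', U', C') \<Longrightarrow>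
      finite U \<Longrightarrow> S \<union> vars t \<subseteq> U \<Longrightarrow>
      finite U' \<and> U \<subseteq> U' \<and> S' = S \<union> vars t \<and> distinct (var_occs t') \<and>
      set (var_occs t') \<subseteq> (vars t - S) \<union> (U' - U) \<and> bot_free t' \<and> funs t' = funs t \<and>
      (wf_trm \<Sigma> t \<longrightarrow> wf_trm \<Sigma> t') \<and>
      (finite C \<longrightarrow> finite C') \<and> (C \<subseteq> range Var \<times> range Var \<longrightarrow> C' \<subseteq> range Var \<times> range Var)"
    and linearizes_props: "linearizes ts (S, U, C) = (ts', S', U', C') \<Longrightarrow>
      finite U \<Longrightarrow> S \<union> (\<Union>t\<in>set ts. vars t) \<subseteq> U \<Longrightarrow>
      finite U' \<and> U \<subseteq> U' \<and> S' = S \<union> (\<Union>t\<in>set ts. vars t) \<and> distinct (vars_occs ts') \<and>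
      set (vars_occs ts') \<subseteq> ((\<Union>t\<in>set ts. vars t) - S) \<union> (U' - U) \<and>
      (\<forall>t\<in>set ts'. bot_free t) \<and> (\<Union>t\<in>set ts'. funs t) = (\<Union>t\<in>set ts. funs t) \<and>
      length ts' = length ts \<and>
      ((\<forall>t\<in>set ts. wf_trm \<Sigma> t) \<longrightarrow> (\<forall>t\<in>set ts'. wf_trm \<Sigma> t)) \<and>
      (finite C \<longrightarrow> finite C') \<and> (C \<subseteq> range Var \<times> range Var \<longrightarrow> C' \<subseteq> range Var \<times> range Var)"
proof (induction t "(S, U, C)" and ts "(S, U, C)"
    arbitrary: S U C t' S' U' C' and S U C ts' S' U' C' rule: linearize_linearizes.induct)
  case (1 x S U C)
  then show ?case
    using fresh_notin[of U] by (auto simp: Let_def split: if_splits)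
next
  case (2 S U C)
  then show ?case
    using fresh_notin[of U] by (auto simp: Let_def)
next
  case (3 c ts S U C)
  obtain ts2 where 1: "linearizes ts (S, U, C) = (ts2, S', U', C')" "t' = Con c ts2"
    using 3(2) by (auto split: prod.splits)
  have "S \<union> (\<Union>t\<in>set ts. vars t) \<subseteq> U"
    using 3(4) by simp
  from "3.hyps"[OF 1(1) 3(3) this] show ?case
    by (simp add: 1(2))
next
  case (4 f ts S U C)
  obtain ts2 where 1: "linearizes ts (S, U, C) = (ts2, S', U', C')" "t' = Fun f ts2"
    using 4(2) by (auto split: prod.splits)
  have "S \<union> (\<Union>t\<in>set ts. vars t) \<subseteq> U"
    using 4(4) by simp
  from "4.hyps"[OF 1(1) 4(3) this] show ?case
    by (simp add: 1(2))
next
  case 5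
  then show ?case
    by auto
next
  case (6 t ts S U C)
  obtain t1 S1 U1 C1 where 1: "linearize t (S, U, C) = (t1, S1, U1, C1)"
    by (metis prod_cases4)
  obtain ts2 where 2: "linearizes ts (S1, U1, C1) = (ts2, S', U', C')" "ts' = t1 # ts2"
    using 6(3) 1 by (auto split: prod.splits)
  note IH1 = "6.hyps"(1)[OF 1]
  note IH2 = "6.hyps"(2)[OF 1[symmetric] refl 2(1)]
  have A: "finite U" "S \<union> vars t \<subseteq> U" "\<Union> (vars ` set ts) \<subseteq> U"
    using 6(4,5) by auto
  note B = IH1[OF A(1,2)]
  have C: "finite U1" "S1 \<union> \<Union> (vars ` set ts) \<subseteq> U1"
    using A B by auto
  note D = IH2[OF C]
  have t1: "U \<subseteq> U1" "S1 = S \<union> vars t" "set (var_occs t1) \<subseteq> (vars t - S) \<union> (U1 - U)"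
    using B by - (elim conjE, assumption)+
  have ts2: "U1 \<subseteq> U'" "S' = S1 \<union> \<Union> (vars ` set ts)"
      "set (vars_occs ts2) \<subseteq> (\<Union> (vars ` set ts) - S1) \<union> (U' - U1)"
    using D by - (elim conjE, assumption)+
  have disj: "set (var_occs t1) \<inter> set (vars_occs ts2) = {}"
  proof (rule ccontr)
    assume "set (var_occs t1) \<inter> set (vars_occs ts2) \<noteq> {}"
    then obtain x where "x \<in> set (var_occs t1)" "x \<in> set (vars_occs ts2)"
      by (metis disjoint_iff)
    with t1(3) ts2(3) have "x \<in> (vars t - S) \<union> (U1 - U)" "x \<in> (\<Union> (vars ` set ts) - S1) \<union> (U' - U1)"
      by (simp_all only: subsetD)
    with A(2,3) t1(1,2) show False
      by (auto simp only: Un_iff Diff_iff subset_iff)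
  qed
  have S': "S' = S \<union> \<Union> (vars ` set (t # ts))"
    by (simp only: t1(2) ts2(2) list.set image_insert Union_insert Un_assoc)
  have vs: "vars_occs ts' = var_occs t1 @ vars_occs ts2"
    by (simp only: 2(2) list.map concat.simps)
  have vt: "\<Union> (vars ` set (t # ts)) = vars t \<union> \<Union> (vars ` set ts)"
    by (simp only: list.set image_insert Union_insert)
  have sub: "set (vars_occs ts') \<subseteq> (\<Union> (vars ` set (t # ts)) - S) \<union> (U' - U)"
    unfolding vs vt set_append
  proof (rule Un_least)
    show "set (var_occs t1) \<subseteq> (vars t \<union> \<Union> (vars ` set ts) - S) \<union> (U' - U)"
      by (rule subset_trans[OF t1(3)]) (use ts2(1) in blast)
    show "set (vars_occs ts2) \<subseteq> (vars t \<union> \<Union> (vars ` set ts) - S) \<union> (U' - U)"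
      by (rule subset_trans[OF ts2(3)]) (use t1(1,2) in blast)
  qed
  have dist: "distinct (vars_occs ts')"
    unfolding vs using B D disj by (simp only: distinct_append simp_thms)
  have "finite U'"
    using D by (rule conjunct1)
  note U = this subset_trans[OF t1(1) ts2(1)]
  have C': "finite C \<longrightarrow> finite C'" "C \<subseteq> range Var \<times> range Var \<longrightarrow> C' \<subseteq> range Var \<times> range Var"
    using B D by argo+
  have b: "bot_free t1" "funs t1 = funs t" "wf_trm \<Sigma> t \<longrightarrow> wf_trm \<Sigma> t1"
    using B by - (elim conjE, assumption)+
  have d: "\<forall>t\<in>set ts2. bot_free t" "\<Union> (funs ` set ts2) = \<Union> (funs ` set ts)"
      "length ts2 = length ts" "(\<forall>t\<in>set ts. wf_trm \<Sigma> t) \<longrightarrow> (\<forall>t\<in>set ts2. wf_trm \<Sigma> t)"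
    using D by - (elim conjE, assumption)+
  have ts': "\<forall>t\<in>set ts'. bot_free t" "\<Union> (funs ` set ts') = \<Union> (funs ` set (t # ts))"
      "length ts' = length (t # ts)"
      "(\<forall>t\<in>set (t # ts). wf_trm \<Sigma> t) \<longrightarrow> (\<forall>t\<in>set ts'. wf_trm \<Sigma> t)"
    using b d by (simp_all add: 2(2))
  show ?case
    by (intro conjI S' sub dist U C' ts')
qed

lemma finite_vars: "finite (vars t)"
  by (induction t) auto

lemma wf_rule_crr:
  fixes ts :: "('c, 'f, 'v::infinite) trm list"
  assumes "f \<in> FS \<Sigma>" "ts \<in> cargs \<Sigma> f" "r \<in> CTerm_bot \<Sigma>"
  shows "wf_rule \<Sigma> (crr f ts r)"
proof -
  let ?U = "(\<Union>t\<in>set ts. vars t) \<union> vars r"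
  obtain ts' S' U' C' where l: "linearizes ts ({}, ?U, {}) = (ts', S', U', C')"
    by (metis prod_cases4)
  have L: "distinct (vars_occs ts')" "\<forall>t\<in>set ts'. bot_free t"
      "(\<Union>t\<in>set ts'. funs t) = (\<Union>t\<in>set ts. funs t)" "length ts' = length ts"
      "(\<forall>t\<in>set ts. wf_trm \<Sigma> t) \<longrightarrow> (\<forall>t\<in>set ts'. wf_trm \<Sigma> t)"
      "finite C'" "C' \<subseteq> range Var \<times> range Var"
    using linearizes_props[OF l, of \<Sigma>] by (auto simp: finite_vars)
  have "{(Var x, Var x) | x. x \<in> vars r \<or> count_list (vars_occs ts) x = 1} \<subseteq>
      (\<lambda>x. (Var x, Var x)) ` (vars r \<union> set (vars_occs ts))"
    using count_list_0_iff[of "vars_occs ts"] by (auto simp del: set_concat)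
  then have "finite {(Var x, Var x) | x. x \<in> vars r \<or> count_list (vars_occs ts) x = 1}"
    by (rule finite_subset) (simp add: finite_vars)
  moreover have "range Var \<subseteq> Term \<Sigma>"
    by (auto simp: Term_def Term_bot_def)
  moreover have "(\<Union>t\<in>set ts'. funs t) = {}" "\<forall>t\<in>set ts. wf_trm \<Sigma> t"
    using assms(2) L(3) by (auto simp: cargs_def CTerm_bot_def Term_bot_def)
  then have "set ts' \<subseteq> CTerm \<Sigma>"
    using L(2,5) by (auto simp: CTerm_def CTerm_bot_def Term_bot_def)
  ultimately show ?thesis
    using assms L by (auto simp: crr_def l wf_rule_def cargs_def CTerm_bot_def)
qed

lemma rhs_crr [simp]: "rhs (crr f ts r) = r"
  by (simp add: crr_def split: prod.splits)

lemma mclosure_modules: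
  fixes P :: "('c, 'f, 'v::infinite) module"
  assumes "\<sigma> \<subseteq> FS \<Sigma>"
  shows "mclosure \<Sigma> P \<sigma> \<in> modules \<Sigma>"
  using assms by (auto simp: modules_iff mclosure_def intro!: wf_rule_crr)

end

theory Submission
  imports Defs
begin

text \<open>Being a model (\<open>\<T>\<^sub>R(\<A>) \<sqsubseteq> \<A>\<close>) is a condition on each rule separately, so model classes of unions
  are intersections, and deletion commutes with unions and, up to preimages, with renamings.
  Moreover \<open>\<A>\<close> is a model of \<open>\<rho>(\<P>)\<close> iff the reduct \<open>\<A> \<circ> \<rho>\<close>, which is again consistent, is a model
  of \<open>\<P>\<close>. The algebra \<open>\<M>\<^sub>P\<close> is the least consistent model of \<open>\<P>\<close>; hence \<open>\<equiv>\<^sub>D\<close> determines \<open>Ob\<close>, and with it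
  the closures, whose rules depend on \<open>\<M>\<^sub>P\<close> only.\<close>

section \<open>Terms and approximation\<close>

lemma in_listset_iff: "us \<in> listset As \<longleftrightarrow> list_all2 (\<in>) us As"
proof (induction As arbitrary: us)
  case (Cons A As)
  then show ?case
    by (cases us) (auto simp: set_Cons_def)
qed simp

lemma CTerm_bot_simps [simp]:
  "Var x \<in> CTerm_bot \<Sigma>"
  "Bot \<in> CTerm_bot \<Sigma>"
  "Con c ts \<in> CTerm_bot \<Sigma> \<longleftrightarrow> c \<in> DS \<Sigma> \<and> length ts = arD \<Sigma> c \<and> set ts \<subseteq> CTerm_bot \<Sigma>"
  "Fun f ts \<notin> CTerm_bot \<Sigma>"
  by (auto simp: CTerm_bot_def Term_bot_def)

lemma CTerm_CTerm_bot: "t \<in> CTerm \<Sigma> \<Longrightarrow> t \<in> CTerm_bot \<Sigma>"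
  by (simp add: CTerm_def)

lemma approx_CTerm_bot: "approx \<Sigma> s t \<Longrightarrow> s \<in> CTerm_bot \<Sigma> \<and> t \<in> CTerm_bot \<Sigma>"
  by (induction rule: approx.induct) (force simp: in_set_conv_nth)+

lemma down_iff: "s \<in> down \<Sigma> t \<longleftrightarrow> approx \<Sigma> s t"
  by (auto simp: down_def dest: approx_CTerm_bot)

text \<open>Since \<open>approx\<close> has transitivity as a rule, its own inversion is useless and
  \<open>approx_shape\<close> takes its place. The alternative \<open>s = Con c ts\<close> allowed
  there is absorbed by reflexivity on the arguments.\<close>

lemma approx_Con_right:
  assumes "approx \<Sigma> s (Con c ts)" "s \<noteq> Bot"
  obtains ss where "s = Con c ss" "list_all2 (approx \<Sigma>) ss ts"
proof (cases "s = Con c ts")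
  case True
  then have "list_all2 (approx \<Sigma>) ts ts"
    using approx_CTerm_bot[OF assms(1)] by (auto simp: list_all2_conv_all_nth intro!: approx_refl)
  with True show thesis
    using that by blast
qed (use approx_shape[OF assms(1)] assms(2) that in auto)

lemma approx_refl_list: "set ts \<subseteq> CTerm_bot \<Sigma> \<Longrightarrow> list_all2 (approx \<Sigma>) ts ts"
  by (auto simp: list_all2_conv_all_nth intro!: approx_refl)

section \<open>Substitutions and rule instances\<close>

lemma subst_CTerm_bot:
  "\<theta> \<in> CSubst_bot \<Sigma> \<Longrightarrow> t \<in> CTerm_bot \<Sigma> \<Longrightarrow> subst \<theta> t \<in> CTerm_bot \<Sigma>"
  by (induction t) (auto simp: CSubst_bot_def subset_iff)

lemma subst_Term_bot: "\<theta> \<in> CSubst_bot \<Sigma> \<Longrightarrow> t \<in> Term_bot \<Sigma> \<Longrightarrow> subst \<theta> t \<in> Term_bot \<Sigma>"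
  by (induction t) (auto simp: CSubst_bot_def CTerm_bot_def Term_bot_def)

lemma CSubst_CSubst_bot: "\<theta> \<in> CSubst \<Sigma> \<Longrightarrow> \<theta> \<in> CSubst_bot \<Sigma>"
  by (auto simp: CSubst_def CSubst_bot_def CTerm_def)

lemma bot_free_subst: "\<theta> \<in> CSubst \<Sigma> \<Longrightarrow> bot_free t \<Longrightarrow> bot_free (subst \<theta> t)"
  by (induction t) (auto simp: CSubst_def CTerm_def)

lemma subst_CTerm: "\<theta> \<in> CSubst \<Sigma> \<Longrightarrow> t \<in> CTerm \<Sigma> \<Longrightarrow> subst \<theta> t \<in> CTerm \<Sigma>"
  by (simp add: CTerm_def subst_CTerm_bot[OF CSubst_CSubst_bot] bot_free_subst)

text \<open>Only a variable could become \<open>Bot\<close>, and a substitution in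
  \<open>CSubst\<close> has \<open>Bot\<close>-free values. This preserves the side condition of
  \<open>OR\<close> in \<open>crwl_subst\<close>.\<close>

lemma subst_neq_Bot:
  assumes "\<theta> \<in> CSubst \<Sigma>" "t \<noteq> Bot"
  shows "subst \<theta> t \<noteq> Bot"
proof (cases t)
  case (Var x)
  have "bot_free (\<theta> x)"
    using assms(1) by (simp add: CSubst_def CTerm_def)
  with Var show ?thesis
    by auto
qed (use assms(2) in auto)

lemma subst_subst: "subst \<theta> (subst \<theta>' t) = subst (\<lambda>x. subst \<theta> (\<theta>' x)) t"
  by (induction t) auto

text \<open>Instances of instances are instances because \<open>CSubst_bot\<close> is closed under
  composition.\<close>

lemma subst_instances:
  assumes "\<theta> \<in> CSubst_bot \<Sigma>" "R \<in> instances \<Sigma> \<R>"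
  shows "subst_rule \<theta> R \<in> instances \<Sigma> \<R>"
proof -
  obtain \<theta>' R' where R: "R = subst_rule \<theta>' R'" "\<theta>' \<in> CSubst_bot \<Sigma>" "R' \<in> \<R>"
    using assms(2) by (auto simp: instances_def)
  let ?\<theta> = "\<lambda>x. subst \<theta> (\<theta>' x)"
  have "?\<theta> \<in> CSubst_bot \<Sigma>"
    using assms(1) R(2) subst_CTerm_bot[OF assms(1)] by (auto simp: CSubst_bot_def)
  moreover have "subst_rule \<theta> R = subst_rule ?\<theta> R'"
    unfolding R(1) by (cases R') (auto simp: subst_subst image_image map_prod_def split_def)
  ultimately show ?thesis
    using R(3) by (auto simp: instances_def)
qed

text \<open>Derivations and models refer to instances, while \<open>program\<close> speaks of the
  rules themselves. Instantiation can introduce \<open>Bot\<close>, so arguments and conditions land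
  in \<open>CTerm_bot\<close> and \<open>Term_bot\<close> instead of \<open>CTerm\<close> and
  \<open>Term\<close>.\<close>

lemma instances_wf:
  assumes "program \<Sigma> \<R>" "Rule f ss r C \<in> instances \<Sigma> \<R>"
  shows "f \<in> FS \<Sigma>" "ss \<in> cargs \<Sigma> f" "r \<in> Term_bot \<Sigma>" "C \<subseteq> Term_bot \<Sigma> \<times> Term_bot \<Sigma>"
proof -
  obtain \<theta> ss' r' C' where R: "\<theta> \<in> CSubst_bot \<Sigma>" "Rule f ss' r' C' \<in> \<R>"
      "ss = map (subst \<theta>) ss'" "r = subst \<theta> r'" "C = map_prod (subst \<theta>) (subst \<theta>) ` C'"
  proof -
    obtain \<theta> R where "Rule f ss r C = subst_rule \<theta> R" "\<theta> \<in> CSubst_bot \<Sigma>" "R \<in> \<R>"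
      using assms(2) by (auto simp: instances_def)
    with that show thesis
      by (cases R) auto
  qed
  have "wf_rule \<Sigma> (Rule f ss' r' C')"
    using assms(1) R(2) by (auto simp: program_def)
  then have w: "f \<in> FS \<Sigma>" "length ss' = arF \<Sigma> f" "set ss' \<subseteq> CTerm \<Sigma>" "r' \<in> Term_bot \<Sigma>"
      "C' \<subseteq> Term \<Sigma> \<times> Term \<Sigma>"
    by (auto simp: wf_rule_def)
  have "Term \<Sigma> \<subseteq> Term_bot \<Sigma>"
    by (auto simp: Term_def)
  with w R show "f \<in> FS \<Sigma>" "ss \<in> cargs \<Sigma> f" "r \<in> Term_bot \<Sigma>" "C \<subseteq> Term_bot \<Sigma> \<times> Term_bot \<Sigma>"
    by (auto simp: cargs_def intro!: subst_Term_bot subst_CTerm_bot dest: CTerm_CTerm_bot)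
qed

section \<open>Derivable reductions\<close>

lemma crwl_CTerm_bot: "crwl \<Sigma> \<R> (Red e t) \<Longrightarrow> t \<in> CTerm_bot \<Sigma>"
  by (induction "Red e t :: ('a, 'b, 'c) formula" arbitrary: e t rule: crwl.induct)
    (auto simp: in_set_conv_nth)

lemma crwl_refl: "t \<in> CTerm_bot \<Sigma> \<Longrightarrow> crwl \<Sigma> \<R> (Red t t)"
proof (induction t)
  case (Con c ts)
  then show ?case
    by (auto simp: subset_iff intro!: crwl.DS)
qed (auto simp: Term_bot_def intro: crwl.Bo crwl.RR_var)

text \<open>\<open>OR\<close> does not itself check the symbol and arity on its left; both come from
  the well-formed rule instance.\<close>

lemma crwl_Term_bot:
  assumes "program \<Sigma> \<R>" "crwl \<Sigma> \<R> (Red e t)"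
  shows "e \<in> Term_bot \<Sigma>"
  using assms(2)
proof (induction "Red e t" arbitrary: e t rule: crwl.induct)
  case (OR f ts r C t es)
  then show ?case
    using instances_wf[OF assms(1) OR(1)] by (auto simp: Term_bot_def cargs_def in_set_conv_nth)
qed (auto simp: Term_bot_def in_set_conv_nth)

lemma crwl_down:
  assumes "program \<Sigma> \<R>" "crwl \<Sigma> \<R> (Red e t)" "approx \<Sigma> s t"
  shows "crwl \<Sigma> \<R> (Red e s)"
\<comment> \<open>\<open>Bot\<close> is split off because \<open>OR\<close> cannot produce it; for
  any other \<open>s\<close> the last rule of the derivation can be reused.\<close>
proof (cases "s = Bot")
  case True
  with crwl_Term_bot[OF assms(1,2)] show ?thesis
    by (simp add: crwl.Bo)
next
  case False
  with assms(2,3) show ?thesis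
  proof (induction "Red e t" arbitrary: e t s rule: crwl.induct)
    case (DS c es ts)
    obtain ss where ss: "s = Con c ss" "list_all2 (approx \<Sigma>) ss ts"
      using approx_Con_right[OF DS(6,7)] by blast
    have "crwl \<Sigma> \<R> (Red (es ! i) (ss ! i))" if "i < arD \<Sigma> c" for i
    \<comment> \<open>The induction hypothesis covers only results other than \<open>Bot\<close>, so
      arguments lowered to \<open>Bot\<close> are handled by \<open>Bo\<close>.\<close>
    proof (cases "ss ! i = Bot")
      case True
      with crwl_Term_bot[OF assms(1) DS(4)[OF that]] show ?thesis
        by (simp add: crwl.Bo)
    next
      case False
      with DS(5)[OF that] ss(2) DS(3) that show ?thesis
        by (auto simp: list_all2_conv_all_nth)
    qed
    with DS(1-3) ss show ?case
      by (auto simp: list_all2_conv_all_nth intro!: crwl.DS)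
  next
    case (OR f ts r C t es)
    show ?case
      by (rule crwl.OR[OF OR(1)]) (use OR in auto)
  qed (auto dest: approx_shape intro: crwl.RR_var crwl.RR_con)
qed

text \<open>\<open>OR\<close> never applies below a constructor term, so a derivation can only
  replace subterms by \<open>Bot\<close>. The converse combines reflexivity of reduction with
  \<open>crwl_down\<close>.\<close>

lemma crwl_CTerm_iff:
  assumes "program \<Sigma> \<R>" "e \<in> CTerm_bot \<Sigma>"
  shows "crwl \<Sigma> \<R> (Red e t) \<longleftrightarrow> approx \<Sigma> t e"
proof
  assume "crwl \<Sigma> \<R> (Red e t)"
  then show "approx \<Sigma> t e"
    using assms(2)
    by (induction "Red e t" arbitrary: e t rule: crwl.induct)
      (auto simp: subset_iff intro!: approx_bot approx_refl approx_con)
qed (use crwl_down[OF assms(1) crwl_refl[OF assms(2)]] in blast)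

text \<open>If the derivation ends in \<open>OR\<close>, its parameters \<open>ts\<close> lie below
  \<open>us\<close> because the \<open>us\<close> are constructor terms. Hence \<open>es\<close>
  reduces to \<open>ts\<close> by downward closure, and the same rule instance applies to
  \<open>es\<close>.\<close>

lemma crwl_Fun_cong:
  assumes "program \<Sigma> \<R>" "crwl \<Sigma> \<R> (Red (Fun f us) t)" "set us \<subseteq> CTerm_bot \<Sigma>"
    and "list_all2 (\<lambda>e u. crwl \<Sigma> \<R> (Red e u)) es us"
  shows "crwl \<Sigma> \<R> (Red (Fun f es) t)"
  using assms(2)
proof (cases rule: crwl.cases)
  case Bo
  moreover have "set es \<subseteq> Term_bot \<Sigma>"
    using assms(4) crwl_Term_bot[OF assms(1)]
    by (fastforce simp: list_all2_conv_all_nth in_set_conv_nth)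
  ultimately show ?thesis
    using list_all2_lengthD[OF assms(4)] by (auto simp: Term_bot_def intro!: crwl.Bo)
next
  case (OR ts r C)
  have "crwl \<Sigma> \<R> (Red (es ! i) (ts ! i))" if "i < length ts" for i
  proof -
    have "us ! i \<in> CTerm_bot \<Sigma>"
      using assms(3) that OR(3) by auto
    then have "approx \<Sigma> (ts ! i) (us ! i)"
      using crwl_CTerm_iff[OF assms(1)] OR(4)[OF that] by blast
    then show ?thesis
      using crwl_down[OF assms(1)] assms(4) that OR(3) by (auto simp: list_all2_conv_all_nth)
  qed
  then show ?thesis
    using OR list_all2_lengthD[OF assms(4)] by (intro crwl.OR[OF OR(1)]) auto
qed

text \<open>Only total substitutions are admissible: \<open>OR\<close> requires the result of the reduction to stay
  different from \<open>\<bottom>\<close>.\<close>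

lemma crwl_subst:
  assumes "\<theta> \<in> CSubst \<Sigma>" "crwl \<Sigma> \<R> \<phi>"
  shows "case \<phi> of Red e t \<Rightarrow> crwl \<Sigma> \<R> (Red (subst \<theta> e) (subst \<theta> t))
    | Join a b \<Rightarrow> crwl \<Sigma> \<R> (Join (subst \<theta> a) (subst \<theta> b))"
  using assms(2)
proof (induction rule: crwl.induct)
  case (Bo e)
  then show ?case
    using subst_Term_bot[OF CSubst_CSubst_bot[OF assms(1)]] by (auto intro: crwl.Bo)
next
  case (RR_var x)
  have "\<theta> x \<in> CTerm_bot \<Sigma>"
    using assms(1) by (auto simp: CSubst_def CTerm_def)
  then show ?case
    by (simp add: crwl_refl)
next
  case (OR f ts r C t es)
  have "Rule f (map (subst \<theta>) ts) (subst \<theta> r) (map_prod (subst \<theta>) (subst \<theta>) ` C) \<in> instances \<Sigma> \<R>"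
    using subst_instances[OF CSubst_CSubst_bot[OF assms(1)] OR(1)] by simp
  then have "crwl \<Sigma> \<R> (Red (Fun f (map (subst \<theta>) es)) (subst \<theta> t))"
    by (rule crwl.OR) (use OR subst_neq_Bot[OF assms(1)] in auto)
  then show ?case
    by simp
next
  case (Jo t a b)
  then show ?case
    using subst_CTerm[OF assms(1)] by (auto intro: crwl.Jo)
qed (auto intro!: crwl.DS crwl.RR_con)

section \<open>The least consistent model\<close>

lemma TAlg_cone: "\<A> \<in> TAlg \<Sigma> \<Longrightarrow> f \<in> FS \<Sigma> \<Longrightarrow> ts \<in> cargs \<Sigma> f \<Longrightarrow> cone \<Sigma> (\<A> f ts)"
  by (simp add: TAlg_def)

lemma Bot_in_cone: "cone \<Sigma> K \<Longrightarrow> Bot \<in> K"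
  unfolding cone_def using approx_bot by blast

text \<open>Every cone contains \<open>Bot\<close>, so the \<open>{Bot}\<close> added by
  \<open>T_op\<close> imposes nothing. What remains is one closure condition for each rule
  instance.\<close>

lemma model_iff:
  assumes "\<A> \<in> TAlg \<Sigma>"
  shows "alg_le \<Sigma> (T_op \<Sigma> \<R> \<A>) \<A> \<longleftrightarrow>
    (\<forall>R\<in>instances \<Sigma> \<R>. head R \<in> FS \<Sigma> \<longrightarrow> (\<forall>ts\<in>cargs \<Sigma> (head R).
       list_all2 (approx \<Sigma>) (largs R) ts \<longrightarrow> sat_conds \<Sigma> \<A> Var (conds R) \<longrightarrow>
       eval \<Sigma> \<A> Var (rhs R) \<subseteq> \<A> (head R) ts))"
    (is "?L \<longleftrightarrow> ?R")
proof
  assume L: ?L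
  show ?R
  proof (intro ballI impI subsetI)
    fix R ts t
    assume *: "R \<in> instances \<Sigma> \<R>" "head R \<in> FS \<Sigma>" "ts \<in> cargs \<Sigma> (head R)"
      "list_all2 (approx \<Sigma>) (largs R) ts" "sat_conds \<Sigma> \<A> Var (conds R)" "t \<in> eval \<Sigma> \<A> Var (rhs R)"
    then have "t \<in> T_op \<Sigma> \<R> \<A> (head R) ts"
      by (cases R) (auto simp: T_op_def)
    with L * show "t \<in> \<A> (head R) ts"
      by (auto simp: alg_le_def)
  qed
next
  assume ?R
  then show ?L
    using Bot_in_cone[OF TAlg_cone[OF assms]] by (fastforce simp: alg_le_def T_op_def)
qed

section \<open>Soundness of derivations in models, and minimality\<close>

text \<open>Each inference rule mirrors a clause of \<open>eval\<close> or \<open>sat_join\<close>,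
  except \<open>OR\<close>, which is where the model condition enters.\<close>

lemma crwl_sound:
  assumes "program \<Sigma> \<R>" "\<A> \<in> TAlg \<Sigma>" "alg_le \<Sigma> (T_op \<Sigma> \<R> \<A>) \<A>" "crwl \<Sigma> \<R> \<phi>"
  shows "case \<phi> of Red e t \<Rightarrow> t \<in> eval \<Sigma> \<A> Var e | Join a b \<Rightarrow> sat_join \<Sigma> \<A> Var a b"
  using assms(4)
proof (induction rule: crwl.induct)
  case (Bo e)
  \<comment> \<open>\<open>Bo\<close> needs \<open>Bot\<close> in every denotation. By induction all
    arguments may take the value \<open>Bot\<close>, and the denotation at that tuple is downward
    closed and non-empty.\<close>
  then have "Bot \<in> eval \<Sigma> \<A> Var e"
  proof (induction e)
    case (Con c es)
    then have "map (\<lambda>_. Bot) es \<in> listset (map (eval \<Sigma> \<A> Var) es)" "c \<in> DS \<Sigma>" "length es = arD \<Sigma> c"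
      by (auto simp: in_listset_iff list_all2_conv_all_nth Term_bot_def)
    then show ?case
      by (auto simp: down_iff intro!: bexI approx_bot)
  next
    case (Fun f es)
    then have "map (\<lambda>_. Bot) es \<in> listset (map (eval \<Sigma> \<A> Var) es)" "f \<in> FS \<Sigma>"
        "map (\<lambda>_. Bot) es \<in> cargs \<Sigma> f"
      by (auto simp: in_listset_iff list_all2_conv_all_nth Term_bot_def cargs_def)
    then show ?case
      using Bot_in_cone[OF TAlg_cone[OF assms(2)]] by auto
  qed (auto simp: down_iff intro!: approx_bot)
  then show ?case
    by simp
next
  case (DS c es ts)
  then have "Con c ts \<in> CTerm_bot \<Sigma>"
    using crwl_CTerm_bot[OF DS(4)] by (auto simp: in_set_conv_nth)
  moreover have "ts \<in> listset (map (eval \<Sigma> \<A> Var) es)"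
    using DS by (auto simp: in_listset_iff list_all2_conv_all_nth)
  ultimately show ?case
    by (auto simp: down_iff simp del: CTerm_bot_simps intro!: approx_refl)
next
  case (OR f ts r C t es)
  note wf = instances_wf[OF assms(1) OR(1)]
  have "sat_conds \<Sigma> \<A> Var C"
    using OR by (auto simp: sat_conds_def)
  \<comment> \<open>The model condition is used at the parameters \<open>ts\<close> of the instance
    themselves, which are values of \<open>es\<close> by the induction hypothesis.\<close>
  moreover have "list_all2 (approx \<Sigma>) ts ts"
    using wf(2) by (intro approx_refl_list) (simp add: cargs_def)
  ultimately have "t \<in> \<A> f ts"
    using assms(3) OR wf(1,2) unfolding model_iff[OF assms(2)] by force
  moreover have "ts \<in> listset (map (eval \<Sigma> \<A> Var) es)"
    using OR by (auto simp: in_listset_iff list_all2_conv_all_nth)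
  ultimately show ?case
    by auto
qed (auto simp: down_iff sat_join_def in_listset_iff intro!: approx_refl)

text \<open>Soundness places \<open>t\<close> in the denotation of \<open>f\<close> at some tuple
  \<open>us\<close> of values of the arguments \<open>ts\<close>. Such values lie below
  \<open>ts\<close>, and monotonicity moves \<open>t\<close> to \<open>ts\<close>.\<close>

lemma M_alg_least:
  assumes "program \<Sigma> \<R>" "\<A> \<in> TAlg \<Sigma>" "alg_le \<Sigma> (T_op \<Sigma> \<R> \<A>) \<A>"
  shows "alg_le \<Sigma> (M_alg \<Sigma> \<R>) \<A>"
  unfolding alg_le_def
proof (intro ballI subsetI)
  fix f ts t
  assume f: "f \<in> FS \<Sigma>" "ts \<in> cargs \<Sigma> f" and "t \<in> M_alg \<Sigma> \<R> f ts"
  then have "crwl \<Sigma> \<R> (Red (Fun f ts) t)"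
    by (simp add: M_alg_def)
  from crwl_sound[OF assms this]
  obtain us where us: "list_all2 (\<in>) us (map (eval \<Sigma> \<A> Var) ts)" "t \<in> \<A> f us"
    by (auto simp: in_listset_iff)
  have down: "approx \<Sigma> u e" if "u \<in> eval \<Sigma> \<A> Var e" "e \<in> CTerm_bot \<Sigma>" for u e
    using that
  proof (induction e arbitrary: u)
    case (Con c es)
    then obtain vs where vs: "list_all2 (\<in>) vs (map (eval \<Sigma> \<A> Var) es)" "approx \<Sigma> u (Con c vs)"
      by (auto simp: in_listset_iff down_iff)
    then have "approx \<Sigma> (Con c vs) (Con c es)"
      using Con.IH Con.prems(2) by (auto simp: list_all2_conv_all_nth subset_iff intro!: approx_con)
    with vs(2) show ?case
      by (rule approx_trans)
  qed (auto simp: down_iff)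
  then have "list_all2 (approx \<Sigma>) us ts"
    using us(1) f(2) by (auto simp: list_all2_conv_all_nth cargs_def subset_iff)
  moreover from this f(2) have "us \<in> cargs \<Sigma> f"
    by (fastforce simp: list_all2_conv_all_nth cargs_def in_set_conv_nth dest: approx_CTerm_bot)
  ultimately have "\<A> f us \<subseteq> \<A> f ts"
    using assms(2) f by (simp add: TAlg_def)
  with us(2) show "t \<in> \<A> f ts"
    by blast
qed

section \<open>The algebra of provable reductions is a consistent model\<close>

lemma M_alg_TAlg:
  assumes "program \<Sigma> \<R>"
  shows "M_alg \<Sigma> \<R> \<in> TAlg \<Sigma>"
proof -
  have "cone \<Sigma> (M_alg \<Sigma> \<R> f ts)" if f: "f \<in> FS \<Sigma>" "ts \<in> cargs \<Sigma> f" for f ts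
  proof -
    have "Fun f ts \<in> Term_bot \<Sigma>"
      using f by (auto simp: Term_bot_def cargs_def CTerm_bot_def)
    then have "Bot \<in> M_alg \<Sigma> \<R> f ts"
      using f by (simp add: M_alg_def crwl.Bo)
    then show ?thesis
      using f crwl_down[OF assms] approx_CTerm_bot unfolding cone_def M_alg_def by fastforce
  qed
  moreover have "M_alg \<Sigma> \<R> f ss \<subseteq> M_alg \<Sigma> \<R> f ts"
    if f: "f \<in> FS \<Sigma>" "ss \<in> cargs \<Sigma> f" "ts \<in> cargs \<Sigma> f" "list_all2 (approx \<Sigma>) ss ts" for f ss ts
  proof -
    \<comment> \<open>The order reverses: the larger arguments \<open>ts\<close> reduce to the
      smaller \<open>ss\<close>, so whatever is derivable from \<open>ss\<close> is derivable from
      \<open>ts\<close>.\<close>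
    have "list_all2 (\<lambda>e u. crwl \<Sigma> \<R> (Red e u)) ts ss"
      using f crwl_CTerm_iff[OF assms] by (auto simp: list_all2_conv_all_nth cargs_def subset_iff)
    then show ?thesis
      using f crwl_Fun_cong[OF assms] by (auto simp: M_alg_def cargs_def)
  qed
  ultimately show ?thesis
    by (auto simp: TAlg_def M_alg_def)
qed

text \<open>Consistency is closure of provability under total substitutions, applied to the
  reductions of \<open>Fun f ts\<close>.\<close>

lemma M_alg_CTAlg:
  assumes "program \<Sigma> \<R>"
  shows "M_alg \<Sigma> \<R> \<in> CTAlg \<Sigma>"
proof -
  have "subst \<theta> u \<in> M_alg \<Sigma> \<R> f (map (subst \<theta>) ts)"
    if "f \<in> FS \<Sigma>" "ts \<in> cargs \<Sigma> f" "\<theta> \<in> CSubst \<Sigma>" "u \<in> M_alg \<Sigma> \<R> f ts" for f ts \<theta> u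
  proof -
    have "map (subst \<theta>) ts \<in> cargs \<Sigma> f" "subst \<theta> u \<in> CTerm_bot \<Sigma>"
      using that by (auto simp: cargs_def M_alg_def intro!: subst_CTerm_bot[OF CSubst_CSubst_bot])
    moreover have "crwl \<Sigma> \<R> (Red (Fun f ts) u)"
      using that by (simp add: M_alg_def)
    from crwl_subst[OF that(3) this]
    have "crwl \<Sigma> \<R> (Red (Fun f (map (subst \<theta>) ts)) (subst \<theta> u))"
      by simp
    ultimately show ?thesis
      using that(1) by (simp add: M_alg_def)
  qed
  then show ?thesis
    using M_alg_TAlg[OF assms] by (auto simp: CTAlg_def consistent_def)
qed

text \<open>This is completeness: evaluation in \<open>M_alg\<close> yields only provable results.
  Values of the arguments are provable by induction; \<open>DS\<close> with downward closure, or
  \<open>crwl_Fun_cong\<close>, then assembles the derivation.\<close>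

lemma eval_M_alg:
  assumes "program \<Sigma> \<R>"
  shows "e \<in> Term_bot \<Sigma> \<Longrightarrow> t \<in> eval \<Sigma> (M_alg \<Sigma> \<R>) Var e \<Longrightarrow> crwl \<Sigma> \<R> (Red e t)"
proof (induction e arbitrary: t)
  case (Con c es)
  then obtain us where us: "list_all2 (\<in>) us (map (eval \<Sigma> (M_alg \<Sigma> \<R>) Var) es)"
      "approx \<Sigma> t (Con c us)"
    by (auto simp: in_listset_iff down_iff)
  then have "crwl \<Sigma> \<R> (Red (Con c es) (Con c us))"
    using Con by (auto simp: list_all2_conv_all_nth Term_bot_def intro!: crwl.DS)
  with us(2) show ?case
    using crwl_down[OF assms] by blast
next
  case (Fun f es)
  then obtain us where us: "list_all2 (\<in>) us (map (eval \<Sigma> (M_alg \<Sigma> \<R>) Var) es)"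
      "t \<in> M_alg \<Sigma> \<R> f us"
    by (auto simp: in_listset_iff)
  then have "crwl \<Sigma> \<R> (Red (Fun f us) t)" "set us \<subseteq> CTerm_bot \<Sigma>"
    by (auto simp: M_alg_def cargs_def split: if_splits)
  moreover have "list_all2 (\<lambda>e u. crwl \<Sigma> \<R> (Red e u)) es us"
    using us(1) Fun by (auto simp: list_all2_conv_all_nth Term_bot_def)
  ultimately show ?case
    by (rule crwl_Fun_cong[OF assms])
qed (auto simp: down_iff crwl_CTerm_iff[OF assms])

text \<open>By \<open>eval_M_alg\<close>, satisfied conditions are derivable with \<open>Jo\<close>
  and values of the right-hand side are derivable reductions. These are the premises of
  \<open>OR\<close>.\<close>

lemma M_alg_model:
  assumes "program \<Sigma> \<R>"
  shows "alg_le \<Sigma> (T_op \<Sigma> \<R> (M_alg \<Sigma> \<R>)) (M_alg \<Sigma> \<R>)"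
  unfolding model_iff[OF M_alg_TAlg[OF assms]]
proof (intro ballI impI subsetI)
  fix R ts t
  assume *: "R \<in> instances \<Sigma> \<R>" "head R \<in> FS \<Sigma>" "ts \<in> cargs \<Sigma> (head R)"
    "list_all2 (approx \<Sigma>) (largs R) ts" "sat_conds \<Sigma> (M_alg \<Sigma> \<R>) Var (conds R)"
    "t \<in> eval \<Sigma> (M_alg \<Sigma> \<R>) Var (rhs R)"
  obtain f ss r C where R_eq: "R = Rule f ss r C"
    by (cases R)
  with * have R: "Rule f ss r C \<in> instances \<Sigma> \<R>" and ts: "f \<in> FS \<Sigma>" "ts \<in> cargs \<Sigma> f"
      "list_all2 (approx \<Sigma>) ss ts" and C: "sat_conds \<Sigma> (M_alg \<Sigma> \<R>) Var C"
    and t: "t \<in> eval \<Sigma> (M_alg \<Sigma> \<R>) Var r"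
    by simp_all
  note wf = instances_wf[OF assms R]
  note r = eval_M_alg[OF assms wf(3) t]
  have "crwl \<Sigma> \<R> (Join a b)" if "(a, b) \<in> C" for a b
    using C that wf(4) unfolding sat_conds_def sat_join_def
    by (blast intro: crwl.Jo eval_M_alg[OF assms])
  moreover have "crwl \<Sigma> \<R> (Red (ts ! i) (ss ! i))" if "i < length ss" for i
    using ts(2,3) that crwl_CTerm_iff[OF assms]
    by (auto simp: list_all2_conv_all_nth cargs_def subset_iff)
  \<comment> \<open>\<open>OR\<close> covers the results other than \<open>Bot\<close>; the
    remaining one is supplied by \<open>Bo\<close>.\<close>
  ultimately have "crwl \<Sigma> \<R> (Red (Fun f ts) t)" if "t \<noteq> Bot"
    using crwl.OR[OF R that] r list_all2_lengthD[OF ts(3)] by auto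
  moreover have "Fun f ts \<in> Term_bot \<Sigma>"
    using ts by (auto simp: Term_bot_def cargs_def CTerm_bot_def)
  ultimately have "crwl \<Sigma> \<R> (Red (Fun f ts) t)"
    using crwl.Bo by blast
  then show "t \<in> M_alg \<Sigma> \<R> (head R) ts"
    using ts crwl_CTerm_bot[OF r] by (simp add: M_alg_def R_eq)
qed

section \<open>Deletion equivalence\<close>

lemma modules_program: "P \<in> modules \<Sigma> \<Longrightarrow> program \<Sigma> (rl P)"
  by (auto simp: modules_def)

lemma rl_mdelete [simp]: "rl (mdelete P \<sigma>) = {R \<in> rl P. head R \<notin> \<sigma>}"
  by (simp add: mdelete_def)

text \<open>Each of the two algebras is a consistent model of its own module, hence by the
  equivalence of the other one. Minimality then gives both inclusions.\<close>

lemma CM_equiv_Ob: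
  assumes "P \<in> modules \<Sigma>" "Q \<in> modules \<Sigma>" "CM_equiv \<Sigma> P Q"
  shows "Ob \<Sigma> P = Ob \<Sigma> Q"
proof -
  note prog = modules_program[OF assms(1)] modules_program[OF assms(2)]
  note M = M_alg_TAlg[OF prog(1)] M_alg_TAlg[OF prog(2)]
  have "alg_le \<Sigma> (T_op \<Sigma> (rl P) (M_alg \<Sigma> (rl Q))) (M_alg \<Sigma> (rl Q))"
      "alg_le \<Sigma> (T_op \<Sigma> (rl Q) (M_alg \<Sigma> (rl P))) (M_alg \<Sigma> (rl P))"
    using assms(3) M_alg_CTAlg[OF prog(1)] M_alg_CTAlg[OF prog(2)]
      M_alg_model[OF prog(1)] M_alg_model[OF prog(2)]
    by (simp_all add: CM_equiv_def)
  then have "alg_le \<Sigma> (M_alg \<Sigma> (rl P)) (M_alg \<Sigma> (rl Q))" "alg_le \<Sigma> (M_alg \<Sigma> (rl Q)) (M_alg \<Sigma> (rl P))"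
    using M_alg_least[OF prog(1) M(2)] M_alg_least[OF prog(2) M(1)] by blast+
  then have "M_alg \<Sigma> (rl P) f ts = M_alg \<Sigma> (rl Q) f ts" if "f \<in> FS \<Sigma>" "ts \<in> cargs \<Sigma> f" for f ts
    unfolding alg_le_def using that by (meson subset_antisym)
  \<comment> \<open>Outside the proper domain both sides are empty by convention, so the inclusions
    yield equality of functions.\<close>
  moreover have "M_alg \<Sigma> \<R> f ts = {}" if "\<not> (f \<in> FS \<Sigma> \<and> ts \<in> cargs \<Sigma> f)"
    for \<R> and f and ts :: "('a, 'b, 'c) trm list"
    using that by (auto simp: M_alg_def)
  ultimately show ?thesis
    unfolding Ob_def by (intro ext) metis
qed

text \<open>Deleting the empty set leaves the rules unchanged, so \<open>D_equiv\<close> contains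
  \<open>CM_equiv\<close>.\<close>

lemma D_equiv_Ob:
  assumes "P \<in> modules \<Sigma>" "Q \<in> modules \<Sigma>" "D_equiv \<Sigma> P Q"
  shows "Ob \<Sigma> P = Ob \<Sigma> Q"
proof -
  have "CM_equiv \<Sigma> (mdelete P {}) (mdelete Q {})"
    using assms(3) by (auto simp: D_equiv_def)
  then show ?thesis
    using CM_equiv_Ob[OF assms(1,2)] by (simp add: CM_equiv_def)
qed

lemma D_equiv_refl: "D_equiv \<Sigma> P P"
  by (simp add: D_equiv_def CM_equiv_def)

section \<open>Union, deletion and closure\<close>

text \<open>Instances distribute over unions of programs, so \<open>T_op\<close> of a union is the
  pointwise union.\<close>

lemma model_union:
  "alg_le \<Sigma> (T_op \<Sigma> (\<R> \<union> \<R>') \<A>) \<A> \<longleftrightarrow>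
     alg_le \<Sigma> (T_op \<Sigma> \<R> \<A>) \<A> \<and> alg_le \<Sigma> (T_op \<Sigma> \<R>' \<A>) \<A>"
proof -
  have "instances \<Sigma> (\<R> \<union> \<R>') = instances \<Sigma> \<R> \<union> instances \<Sigma> \<R>'"
    by (auto simp: instances_def)
  then have "T_op \<Sigma> (\<R> \<union> \<R>') \<A> f ts = T_op \<Sigma> \<R> \<A> f ts \<union> T_op \<Sigma> \<R>' \<A> f ts" for f ts
    by (auto simp: T_op_def)
  then show ?thesis
    unfolding alg_le_def by (simp only: Un_subset_iff) blast
qed

lemma D_equiv_munion:
  assumes "D_equiv \<Sigma> P P'" "D_equiv \<Sigma> Q Q'"
  shows "D_equiv \<Sigma> (munion P Q) (munion P' Q')"
proof -
  have "rl (mdelete (munion M N) \<sigma>) = rl (mdelete M \<sigma>) \<union> rl (mdelete N \<sigma>)"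
    for M N :: "('a, 'b, 'c) module" and \<sigma>
    by (auto simp: munion_def)
  then show ?thesis
    using assms unfolding D_equiv_def CM_equiv_def by (simp only: model_union) blast
qed

text \<open>Two successive deletions amount to deleting the union of the two sets, which is again a
  subset of \<open>FS\<close>.\<close>

lemma D_equiv_mdelete:
  assumes "D_equiv \<Sigma> P Q" "\<sigma> \<subseteq> FS \<Sigma>"
  shows "D_equiv \<Sigma> (mdelete P \<sigma>) (mdelete Q \<sigma>)"
proof -
  have "mdelete (mdelete M \<sigma>) \<sigma>' = mdelete M (\<sigma> \<union> \<sigma>')" for M :: "('a, 'b, 'c) module" and \<sigma>'
    by (auto simp: mdelete_def intro!: arg_cong[of _ _ module_of])
  then show ?thesis
    using assms by (simp add: D_equiv_def)
qed

text \<open>The reductions that generate the closure are exactly the memberships recorded in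
  \<open>Ob\<close>. The closures are therefore equal, not merely equivalent.\<close>

lemma mclosure_Ob_cong:
  assumes "Ob \<Sigma> P = Ob \<Sigma> Q" "\<sigma> \<subseteq> FS \<Sigma>"
  shows "mclosure \<Sigma> P \<sigma> = mclosure \<Sigma> Q \<sigma>"
proof -
  have "crwl \<Sigma> (rl P) (Red (Fun f ts) r) \<longleftrightarrow> crwl \<Sigma> (rl Q) (Red (Fun f ts) r)"
    if "f \<in> \<sigma>" "ts \<in> cargs \<Sigma> f" "r \<in> CTerm_bot \<Sigma>" for f ts r
  proof -
    have "r \<in> M_alg \<Sigma> (rl P) f ts \<longleftrightarrow> r \<in> M_alg \<Sigma> (rl Q) f ts"
      using assms(1) by (simp add: Ob_def)
    with that assms(2) show ?thesis
      by (auto simp: M_alg_def)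
  qed
  then show ?thesis
    unfolding mclosure_def by (intro arg_cong[of _ _ module_of]) blast
qed

section \<open>Renaming\<close>

text \<open>The guard enforces the convention that denotations are empty outside \<open>FS\<close>.\<close>

definition reduct ::
  "('c, 'f) signature \<Rightarrow> ('f \<Rightarrow> 'f) \<Rightarrow> ('c, 'f, 'v) algebra \<Rightarrow> ('c, 'f, 'v) algebra" where
  "reduct \<Sigma> \<rho> \<A> f ts = (if f \<in> FS \<Sigma> then \<A> (\<rho> f) ts else {})"

lemma cargs_renaming: "renaming \<Sigma> \<rho> \<Longrightarrow> f \<in> FS \<Sigma> \<Longrightarrow> cargs \<Sigma> (\<rho> f) = cargs \<Sigma> f"
  by (simp add: cargs_def renaming_def)

text \<open>Each requirement on the reduct at \<open>f\<close> is the requirement on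
  \<open>\<A>\<close> at \<open>\<rho> f\<close>, since renaming preserves the admissible argument
  tuples.\<close>

lemma reduct_CTAlg:
  assumes "renaming \<Sigma> \<rho>" "\<A> \<in> CTAlg \<Sigma>"
  shows "reduct \<Sigma> \<rho> \<A> \<in> CTAlg \<Sigma>"
proof -
  note c = cargs_renaming[OF assms(1)]
  have \<rho>: "\<rho> f \<in> FS \<Sigma>" if "f \<in> FS \<Sigma>" for f
    using assms(1) that by (simp add: renaming_def)
  have A: "\<A> \<in> TAlg \<Sigma>" "consistent \<Sigma> \<A>"
    using assms(2) by (simp_all add: CTAlg_def)
  note T = A(1)[unfolded TAlg_def mem_Collect_eq]
  have "reduct \<Sigma> \<rho> \<A> \<in> TAlg \<Sigma>"
    unfolding TAlg_def mem_Collect_eq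
  proof (intro conjI ballI allI impI)
    fix f and ts :: "('a, 'b, 'c) trm list"
    assume f: "f \<in> FS \<Sigma>" "ts \<in> cargs \<Sigma> f"
    show "cone \<Sigma> (reduct \<Sigma> \<rho> \<A> f ts)"
      using conjunct1[OF T] f \<rho>[OF f(1)] by (simp add: reduct_def c)
  next
    fix f and ss ts :: "('a, 'b, 'c) trm list"
    assume f: "f \<in> FS \<Sigma>" "ss \<in> cargs \<Sigma> f" "ts \<in> cargs \<Sigma> f" "list_all2 (approx \<Sigma>) ss ts"
    show "reduct \<Sigma> \<rho> \<A> f ss \<subseteq> reduct \<Sigma> \<rho> \<A> f ts"
      using conjunct1[OF conjunct2[OF T]] f \<rho>[OF f(1)] by (simp add: reduct_def c)
  next
    fix f and ts :: "('a, 'b, 'c) trm list"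
    assume "f \<notin> FS \<Sigma> \<or> ts \<notin> cargs \<Sigma> f"
    then show "reduct \<Sigma> \<rho> \<A> f ts = {}"
      using conjunct2[OF conjunct2[OF T]] by (auto simp: reduct_def c)
  qed
  moreover have "consistent \<Sigma> (reduct \<Sigma> \<rho> \<A>)"
    using A(2) \<rho> unfolding consistent_def reduct_def by (simp add: c)
  ultimately show ?thesis
    by (simp add: CTAlg_def)
qed

text \<open>In a well-formed term all function symbols lie in \<open>FS\<close>, so the guard in
  \<open>reduct\<close> is always satisfied.\<close>

lemma eval_reduct:
  "e \<in> Term_bot \<Sigma> \<Longrightarrow> eval \<Sigma> (reduct \<Sigma> \<rho> \<A>) \<eta> e = eval \<Sigma> \<A> \<eta> (rename_trm \<rho> e)"
proof (induction e)
  case (Con c es)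
  then have "map (eval \<Sigma> (reduct \<Sigma> \<rho> \<A>) \<eta>) es = map (eval \<Sigma> \<A> \<eta>) (map (rename_trm \<rho>) es)"
    by (auto simp: Term_bot_def id_def)
  then show ?case
    by (simp only: eval.simps trm.map id_def)
next
  case (Fun f es)
  then have "map (eval \<Sigma> (reduct \<Sigma> \<rho> \<A>) \<eta>) es = map (eval \<Sigma> \<A> \<eta>) (map (rename_trm \<rho>) es)"
      "f \<in> FS \<Sigma>"
    by (auto simp: Term_bot_def id_def)
  moreover from this have "reduct \<Sigma> \<rho> \<A> f = \<A> (\<rho> f)"
    by (simp add: reduct_def fun_eq_iff)
  ultimately show ?case
    by (simp only: eval.simps trm.map id_def)
qed auto

lemma rename_CTerm_bot: "t \<in> CTerm_bot \<Sigma> \<Longrightarrow> rename_trm \<rho> t = t"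
  by (induction t) (auto simp: subset_iff intro!: map_idI)

text \<open>The values of \<open>\<theta>\<close> contain no function symbols, hence renaming fixes
  them.\<close>

lemma rename_subst:
  "\<theta> \<in> CSubst_bot \<Sigma> \<Longrightarrow> rename_trm \<rho> (subst \<theta> t) = subst \<theta> (rename_trm \<rho> t)"
proof (induction t)
  case (Var x)
  then have "\<theta> x \<in> CTerm_bot \<Sigma>"
    by (simp add: CSubst_bot_def)
  from rename_CTerm_bot[OF this, of \<rho>] show ?case
    by (simp add: id_def)
qed auto

lemma instances_rename:
  "instances \<Sigma> (rename_rule \<rho> ` \<R>) = rename_rule \<rho> ` instances \<Sigma> \<R>"
proof -
  have "subst_rule \<theta> (rename_rule \<rho> R) = rename_rule \<rho> (subst_rule \<theta> R)"
    if "\<theta> \<in> CSubst_bot \<Sigma>" for \<theta> and R :: "('a, 'b, 'c) rule"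
    using that by (cases R) (auto simp: rename_subst image_image map_prod_def split_def)
  then show ?thesis
    unfolding instances_def by (auto simp: image_iff) metis+
qed

text \<open>The two model conditions agree instance by instance: \<open>eval_reduct\<close> matches
  conditions and right-hand sides, and the denotation of \<open>\<rho> f\<close> in
  \<open>\<A>\<close> is that of \<open>f\<close> in the reduct.\<close>

lemma model_rename:
  assumes "program \<Sigma> \<R>" "renaming \<Sigma> \<rho>" "\<A> \<in> CTAlg \<Sigma>"
  shows "alg_le \<Sigma> (T_op \<Sigma> (rename_rule \<rho> ` \<R>) \<A>) \<A> \<longleftrightarrow>
    alg_le \<Sigma> (T_op \<Sigma> \<R> (reduct \<Sigma> \<rho> \<A>)) (reduct \<Sigma> \<rho> \<A>)"
proof -
  let ?B = "reduct \<Sigma> \<rho> \<A>"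
  have TAlg: "\<A> \<in> TAlg \<Sigma>" "?B \<in> TAlg \<Sigma>"
    using assms(3) reduct_CTAlg[OF assms(2,3)] by (auto simp: CTAlg_def)
  show ?thesis
    \<comment> \<open>\<open>ball_simps(9)\<close> turns the quantifier over the image of the
      instances under renaming into one over the original instances.\<close>
    unfolding model_iff[OF TAlg(1)] model_iff[OF TAlg(2)] instances_rename ball_simps(9)
  proof (rule ball_cong[OF refl])
    fix R
    assume R: "R \<in> instances \<Sigma> \<R>"
    obtain f ss r C where R_eq: "R = Rule f ss r C"
      by (cases R)
    note wf = instances_wf[OF assms(1) R[unfolded R_eq]]
    \<comment> \<open>The parameters of an instance are constructor terms, so renaming leaves them
      alone.\<close>
    have "map (rename_trm \<rho>) ss = ss"
      using wf(2) by (auto simp: cargs_def rename_CTerm_bot intro!: map_idI)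
    moreover have "sat_conds \<Sigma> \<A> Var (map_prod (rename_trm \<rho>) (rename_trm \<rho>) ` C) \<longleftrightarrow>
        sat_conds \<Sigma> ?B Var C"
      using wf(4) by (fastforce simp: sat_conds_def sat_join_def eval_reduct)
    moreover have "\<rho> f \<in> FS \<Sigma>"
      using assms(2) wf(1) by (simp add: renaming_def)
    ultimately show "(head (rename_rule \<rho> R) \<in> FS \<Sigma> \<longrightarrow> (\<forall>ts\<in>cargs \<Sigma> (head (rename_rule \<rho> R)).
          list_all2 (approx \<Sigma>) (largs (rename_rule \<rho> R)) ts \<longrightarrow>
          sat_conds \<Sigma> \<A> Var (conds (rename_rule \<rho> R)) \<longrightarrow>
          eval \<Sigma> \<A> Var (rhs (rename_rule \<rho> R)) \<subseteq> \<A> (head (rename_rule \<rho> R)) ts)) \<longleftrightarrow>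
        (head R \<in> FS \<Sigma> \<longrightarrow> (\<forall>ts\<in>cargs \<Sigma> (head R). list_all2 (approx \<Sigma>) (largs R) ts \<longrightarrow>
          sat_conds \<Sigma> ?B Var (conds R) \<longrightarrow> eval \<Sigma> ?B Var (rhs R) \<subseteq> ?B (head R) ts))"
      using wf(1,3) by (simp add: R_eq eval_reduct reduct_def cargs_renaming[OF assms(2)])
  qed
qed

lemma D_equiv_mrename:
  assumes "P \<in> modules \<Sigma>" "Q \<in> modules \<Sigma>" "renaming \<Sigma> \<rho>" "D_equiv \<Sigma> P Q"
  shows "D_equiv \<Sigma> (mrename \<rho> P) (mrename \<rho> Q)"
  unfolding D_equiv_def CM_equiv_def
proof (intro allI impI ballI)
  fix \<sigma> and \<A> :: "('a, 'b, 'c) algebra"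
  assume \<A>: "\<A> \<in> CTAlg \<Sigma>"
  \<comment> \<open>Deleting \<sigma> after renaming is the same as deleting its preimage first. As
    \<rho> may identify symbols, the whole preimage is taken; intersecting with \<open>FS\<close>
    makes it an admissible set for \<open>D_equiv\<close>.\<close>
  let ?\<tau> = "{f \<in> FS \<Sigma>. \<rho> f \<in> \<sigma>}"
  have "alg_le \<Sigma> (T_op \<Sigma> (rl (mdelete (mrename \<rho> M) \<sigma>)) \<A>) \<A> \<longleftrightarrow>
      alg_le \<Sigma> (T_op \<Sigma> (rl (mdelete M ?\<tau>)) (reduct \<Sigma> \<rho> \<A>)) (reduct \<Sigma> \<rho> \<A>)"
    if "M \<in> modules \<Sigma>" for M
  proof -
    have "head (rename_rule \<rho> R) = \<rho> (head R)" for R :: "('a, 'b, 'c) rule"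
      by (cases R) simp
    moreover have "head R \<in> FS \<Sigma>" if "R \<in> rl M" for R
      using \<open>M \<in> modules \<Sigma>\<close> that by (auto simp: modules_iff wf_rule_def)
    ultimately have "rl (mdelete (mrename \<rho> M) \<sigma>) = rename_rule \<rho> ` rl (mdelete M ?\<tau>)"
      by (auto simp: mrename_def)
    then show ?thesis
      by (simp only: model_rename[OF modules_program[OF mdelete_modules[OF that]] assms(3) \<A>])
  qed
  moreover have "?\<tau> \<subseteq> FS \<Sigma>"
    by blast
  ultimately show "alg_le \<Sigma> (T_op \<Sigma> (rl (mdelete (mrename \<rho> P) \<sigma>)) \<A>) \<A> \<longleftrightarrow>
      alg_le \<Sigma> (T_op \<Sigma> (rl (mdelete (mrename \<rho> Q) \<sigma>)) \<A>) \<A>"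
    using assms(1,2,4) reduct_CTAlg[OF assms(3) \<A>] unfolding D_equiv_def CM_equiv_def by blast
qed

theorem theorem7p2:
  fixes \<Sigma> :: "('c, 'f) signature"
    and P Q P\<^sub>1 P\<^sub>2 Q\<^sub>1 Q\<^sub>2 :: "('c, 'f, 'v :: {countable, infinite}) module"
  assumes "wf_signature \<Sigma>"
    and "P \<in> modules \<Sigma>" and "Q \<in> modules \<Sigma>"
    and "P\<^sub>1 \<in> modules \<Sigma>" and "P\<^sub>2 \<in> modules \<Sigma>"
    and "Q\<^sub>1 \<in> modules \<Sigma>" and "Q\<^sub>2 \<in> modules \<Sigma>"
  shows "(D_equiv \<Sigma> P Q \<longrightarrow> Ob \<Sigma> P = Ob \<Sigma> Q) \<and>
    (D_equiv \<Sigma> P\<^sub>1 Q\<^sub>1 \<and> D_equiv \<Sigma> P\<^sub>2 Q\<^sub>2 \<longrightarrow>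
       D_equiv \<Sigma> (munion P\<^sub>1 P\<^sub>2) (munion Q\<^sub>1 Q\<^sub>2)) \<and>
    (D_equiv \<Sigma> P Q \<longrightarrow>
       (\<forall>\<sigma>\<subseteq>FS \<Sigma>. D_equiv \<Sigma> (mclosure \<Sigma> P \<sigma>) (mclosure \<Sigma> Q \<sigma>))) \<and>
    (D_equiv \<Sigma> P Q \<longrightarrow>
       (\<forall>\<sigma>\<subseteq>FS \<Sigma>. D_equiv \<Sigma> (mdelete P \<sigma>) (mdelete Q \<sigma>))) \<and>
    (D_equiv \<Sigma> P Q \<longrightarrow>
       (\<forall>\<rho>. renaming \<Sigma> \<rho> \<longrightarrow> D_equiv \<Sigma> (mrename \<rho> P) (mrename \<rho> Q))) \<and>
    equiv (modules \<Sigma>) {(M :: ('c, 'f, 'v) module, N). M \<in> modules \<Sigma> \<and> N \<in> modules \<Sigma> \<and> D_equiv \<Sigma> M N}"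
proof (intro conjI impI allI)
  show "Ob \<Sigma> P = Ob \<Sigma> Q" if "D_equiv \<Sigma> P Q"
    by (rule D_equiv_Ob[OF assms(2,3) that])
  show "D_equiv \<Sigma> (munion P\<^sub>1 P\<^sub>2) (munion Q\<^sub>1 Q\<^sub>2)" if "D_equiv \<Sigma> P\<^sub>1 Q\<^sub>1 \<and> D_equiv \<Sigma> P\<^sub>2 Q\<^sub>2"
    using that D_equiv_munion by blast
  show "D_equiv \<Sigma> (mclosure \<Sigma> P \<sigma>) (mclosure \<Sigma> Q \<sigma>)" if "D_equiv \<Sigma> P Q" "\<sigma> \<subseteq> FS \<Sigma>" for \<sigma>
    using mclosure_Ob_cong[OF D_equiv_Ob[OF assms(2,3) that(1)] that(2)] D_equiv_refl by simp
  show "D_equiv \<Sigma> (mdelete P \<sigma>) (mdelete Q \<sigma>)" if "D_equiv \<Sigma> P Q" "\<sigma> \<subseteq> FS \<Sigma>" for \<sigma>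
    using that by (rule D_equiv_mdelete)
  show "D_equiv \<Sigma> (mrename \<rho> P) (mrename \<rho> Q)" if "D_equiv \<Sigma> P Q" "renaming \<Sigma> \<rho>" for \<rho>
    by (rule D_equiv_mrename[OF assms(2,3) that(2,1)])
  show "equiv (modules \<Sigma>)
      {(M :: ('c, 'f, 'v) module, N). M \<in> modules \<Sigma> \<and> N \<in> modules \<Sigma> \<and> D_equiv \<Sigma> M N}"
    by (auto simp: equiv_def refl_on_def sym_def trans_def D_equiv_def CM_equiv_def)
qed

end
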